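(* Let $m\ge2$ and let $\mathbf r(t)=\sum_{i=0}^{3m+13}\mathbf r_iN^5_{i,\rho}(t)$, $t\in[t_2,t_{m+3}]$, be a closed quintic Pythagorean-Hodograph B-spline curve with $\mathbf r'=\mathbf z^2=\sum_{k=0}^{3m+12}\mathbf p_kN^4_{k,\nu}$ and $|\mathbf r'|=\sum_{k=0}^{3m+12}\sigma_kN^4_{k,\nu}$ as described in the context, with $\mathbf z(t)\ne0$ on $[t_2,t_{m+3}]$. Let $\tau=\{\langle t_{-1}\rangle^5<\langle t_0\rangle^8<\langle t_1\rangle^8<\dots<\langle t_{m+5}\rangle^8<\langle t_{m+6}\rangle^5\}$, and for $0\le k\le m+3$ put $E_k=d_{k+1}+d_{k+2}$, $$S_k=\tfrac{\sigma_{3k+2}d_{k+1}+\sigma_{3k+1}d_{k+2}}{E_k},\quad \mathbf P_k=\tfrac{\mathbf p_{3k+2}d_{k+1}+\mathbf p_{3k+1}d_{k+2}}{E_k},\quad \mathbf U_k=\tfrac{\mathbf r_{3k+2}d_{k+1}+\mathbf r_{3k+1}d_{k+2}}{E_k},$$ $$\mathbf V_k=\tfrac{\mathbf r_{3k+3}d_{k+1}+\mathbf r_{3k+2}d_{k+2}}{E_k},\quad \mathbf Q_k=\tfrac{\mathbf r_{3k+3}d_{k+1}^2+2\mathbf r_{3k+2}d_{k+1}d_{k+2}+\mathbf r_{3k+1}d_{k+2}^2}{E_k^2}.$$ Then for every $h\in\mathbb R$ the offset curve $\mathbf r_h=\mathbf r-\mathrm i h\,\mathbf r'/|\mathbf r'|$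 equals $$\mathbf r_h(t)=\frac{\sum_{k=0}^{8m+47}\mathbf q_kN^9_{k,\tau}(t)}{\sum_{k=0}^{8m+47}\gamma_kN^9_{k,\tau}(t)},\quad t\in[t_2,t_{m+3}],$$ with the following weights and control points. $\gamma_k=0$, $\mathbf q_k=0$ for $0\le k\le6$ and $8m+41\le k\le8m+47$. With $\lambda_7=\frac1{126}\big(\frac{d_0}{d_0+d_1}\big)^2\frac{d_1}{d_1+d_2}$, $\lambda_8=\frac5{126}\frac{d_0}{d_0+d_1}\frac{d_1}{d_1+d_2}$, $\lambda_9=\frac5{42}\frac{d_1}{d_1+d_2}$, $\lambda_{10}=\frac5{18}\frac{d_1}{d_1+d_2}$: $\gamma_k=\lambda_k\sigma_2$ for $k=7,8,9,10$, $\mathbf q_k=\lambda_k(\mathbf r_0\sigma_2-\mathrm i h\mathbf p_2)$ for $k=7,8,9$, $\mathbf q_{10}=\lambda_{10}(\mathbf r_1\sigma_2-\mathrm i h\mathbf p_2)$. With $\lambda'_{37}=\frac5{18}\frac{d_{m+5}}{d_{m+4}+d_{m+5}}$, $\lambda'_{38}=\frac5{42}\frac{d_{m+5}}{d_{m+4}+d_{m+5}}$, $\lambda'_{39}=\frac5{126}\frac{d_{m+6}}{d_{m+5}+d_{m+6}}\frac{d_{m+5}}{d_{m+4}+d_{m+5}}$, $\lambda'_{40}=\frac1{126}\big(\frac{d_{m+6}}{d_{m+5}+d_{m+6}}\big)^2\frac{d_{m+5}}{d_{m+4}+d_{m+5}}$: $\gamma_{8m+j}=\lambda'_j\sigma_{3m+10}$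 for $j=37,\dots,40$, $\mathbf q_{8m+37}=\lambda'_{37}(\mathbf r_{3m+12}\sigma_{3m+10}-\mathrm i h\mathbf p_{3m+10})$, $\mathbf q_{8m+j}=\lambda'_j(\mathbf r_{3m+13}\sigma_{3m+10}-\mathrm i h\mathbf p_{3m+10})$ for $j=38,39,40$. For $0\le k\le m+3$: $$\gamma_{8k+11}=\tfrac49\sigma_{3k+1}+\tfrac59S_k,\quad \gamma_{8k+12}=\tfrac59S_k+\tfrac49\sigma_{3k+2},$$ $$\mathbf q_{8k+11}=\tfrac49\mathbf Q_k\sigma_{3k+1}+\tfrac59\mathbf U_kS_k-\mathrm i h(\tfrac49\mathbf p_{3k+1}+\tfrac59\mathbf P_k),\quad \mathbf q_{8k+12}=\tfrac59\mathbf V_kS_k+\tfrac49\mathbf Q_k\sigma_{3k+2}-\mathrm i h(\tfrac49\mathbf p_{3k+2}+\tfrac59\mathbf P_k).$$ For $0\le k\le m+2$: $$\gamma_{8k+13}=\tfrac5{18}S_k+\tfrac59\sigma_{3k+2}+\tfrac16\sigma_{3k+3},\quad \gamma_{8k+14}=\tfrac5{42}S_k+\tfrac{10}{21}\sigma_{3k+2}+\tfrac5{14}\sigma_{3k+3}+\tfrac1{21}\sigma_{3k+4},$$ $$\gamma_{8k+15}=\tfrac5{126}S_k+\tfrac{20}{63}\sigma_{3k+2}+\tfrac{10}{21}\sigma_{3k+3}+\tfrac{10}{63}\sigma_{3k+4}+\tfrac1{126}S_{k+1},$$ $$\gamma_{8k+16}=\tfrac1{126}S_k+\tfrac{10}{63}\sigma_{3k+2}+\tfrac{10}{21}\sigma_{3k+3}+\tfrac{20}{63}\sigma_{3k+4}+\tfrac5{126}S_{k+1},$$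 $$\gamma_{8k+17}=\tfrac1{21}\sigma_{3k+2}+\tfrac5{14}\sigma_{3k+3}+\tfrac{10}{21}\sigma_{3k+4}+\tfrac5{42}S_{k+1},\quad \gamma_{8k+18}=\tfrac16\sigma_{3k+3}+\tfrac59\sigma_{3k+4}+\tfrac5{18}S_{k+1},$$ $$\mathbf q_{8k+13}=\tfrac5{18}\mathbf r_{3k+3}S_k+\tfrac59\mathbf V_k\sigma_{3k+2}+\tfrac16\mathbf Q_k\sigma_{3k+3}-\mathrm i h(\tfrac16\mathbf p_{3k+3}+\tfrac59\mathbf p_{3k+2}+\tfrac5{18}\mathbf P_k),$$ $$\mathbf q_{8k+14}=\tfrac5{42}\mathbf r_{3k+4}S_k+\tfrac{10}{21}\mathbf r_{3k+3}\sigma_{3k+2}+\tfrac5{14}\mathbf V_k\sigma_{3k+3}+\tfrac1{21}\mathbf Q_k\sigma_{3k+4}-\mathrm i h(\tfrac1{21}\mathbf p_{3k+4}+\tfrac5{14}\mathbf p_{3k+3}+\tfrac{10}{21}\mathbf p_{3k+2}+\tfrac5{42}\mathbf P_k),$$ $$\mathbf q_{8k+15}=\tfrac5{126}\mathbf U_{k+1}S_k+\tfrac{20}{63}\mathbf r_{3k+4}\sigma_{3k+2}+\tfrac{10}{21}\mathbf r_{3k+3}\sigma_{3k+3}+\tfrac{10}{63}\mathbf V_k\sigma_{3k+4}+\tfrac1{126}\mathbf Q_kS_{k+1}-\mathrm i h(\tfrac1{126}\mathbf P_{k+1}+\tfrac{10}{63}\mathbf p_{3k+4}+\tfrac{10}{21}\mathbf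 p_{3k+3}+\tfrac{20}{63}\mathbf p_{3k+2}+\tfrac5{126}\mathbf P_k),$$ $$\mathbf q_{8k+16}=\tfrac1{126}\mathbf Q_{k+1}S_k+\tfrac{10}{63}\mathbf U_{k+1}\sigma_{3k+2}+\tfrac{10}{21}\mathbf r_{3k+4}\sigma_{3k+3}+\tfrac{20}{63}\mathbf r_{3k+3}\sigma_{3k+4}+\tfrac5{126}\mathbf V_kS_{k+1}-\mathrm i h(\tfrac5{126}\mathbf P_{k+1}+\tfrac{20}{63}\mathbf p_{3k+4}+\tfrac{10}{21}\mathbf p_{3k+3}+\tfrac{10}{63}\mathbf p_{3k+2}+\tfrac1{126}\mathbf P_k),$$ $$\mathbf q_{8k+17}=\tfrac1{21}\mathbf Q_{k+1}\sigma_{3k+2}+\tfrac5{14}\mathbf U_{k+1}\sigma_{3k+3}+\tfrac{10}{21}\mathbf r_{3k+4}\sigma_{3k+4}+\tfrac5{42}\mathbf r_{3k+3}S_{k+1}-\mathrm i h(\tfrac5{42}\mathbf P_{k+1}+\tfrac{10}{21}\mathbf p_{3k+4}+\tfrac5{14}\mathbf p_{3k+3}+\tfrac1{21}\mathbf p_{3k+2}),$$ $$\mathbf q_{8k+18}=\tfrac16\mathbf Q_{k+1}\sigma_{3k+3}+\tfrac59\mathbf U_{k+1}\sigma_{3k+4}+\tfrac5{18}\mathbf r_{3k+4}S_{k+1}-\mathrm i h(\tfrac5{18}\mathbf P_{k+1}+\tfrac59\mathbf p_{3k+4}+\tfrac16\mathbf p_{3k+3}).$$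
   Context: Normalized B-splines: for a nondecreasing knot sequence $\mu=\{t_i\}$, $N^0_{i,\mu}(t)=1$ if $t\in[t_i,t_{i+1})$ and $0$ otherwise, and $N^n_{i,\mu}(t)=\frac{t-t_i}{t_{i+n}-t_i}N^{n-1}_{i,\mu}(t)+\frac{t_{i+n+1}-t}{t_{i+n+1}-t_{i+1}}N^{n-1}_{i+1,\mu}(t)$ with $0/0=0$; indexing starts at $0$. $\langle t\rangle^k$ denotes the knot $t$ repeated $k$ times. Points of $\mathbb R^2$ are identified with complex numbers. Data: $t_{-1}<0=t_0<t_1<\dots<t_{m+5}<t_{m+6}$, $d_k=t_k-t_{k-1}$, with $d_{m+3}=d_2$, $d_{m+4}=d_3$; $\mathbf z_0,\dots,\mathbf z_{m+2}\in\mathbb C$, $\mu=\{t_0,\dots,t_{m+5}\}$, $\mathbf z(t)=\sum_{i=0}^{m+2}\mathbf z_iN^2_{i,\mu}(t)$; $\nu=\{s_i\}=\{\langle t_0\rangle^3<\dots<\langle t_{m+5}\rangle^3\}$, $\rho=\{t_{-1}<\langle t_0\rangle^3<\dots<\langle t_{m+5}\rangle^3<t_{m+6}\}$. The $\mathbf p_k$ and $\sigma_k$ ($0\le k\le3m+12$) are the unique coefficients with $\mathbf z^2=\sum_k\mathbf p_kN^4_{k,\nu}$ and $\mathbf z\bar{\mathbf z}=\sum_k\sigma_kN^4_{k,\nu}$ on $[t_0,t_{m+5}]$. The closing conditions $\sum_{j=6-k}^{3m+8-k}(s_{j+5}-s_j)\mathbf p_j=0$, $k=0,1,2$, hold. $\mathbf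 r_0$ is arbitrary and $\mathbf r_{i+1}=\mathbf r_i+\frac{s_{i+5}-s_i}5\mathbf p_i$ for $0\le i\le3m+12$; then $\mathbf r'=\mathbf z^2$ on $[t_2,t_{m+3}]$. *)

theory Defs
  imports "HOL-Analysis.Analysis"
begin

text \<open>
  \<open>bspline ts n i x\<close> is the normalized B-spline of degree \<open>n\<close> and index \<open>i\<close> (counted from 0)
  for the nondecreasing knot list \<open>ts\<close>; it refers to the knots \<open>ts ! i, \<dots>, ts ! (i + n + 1)\<close>
  only. A vanishing denominator comes with an identically vanishing lower-degree B-spline, so the
  convention \<open>0/0 = 0\<close> is covered by \<open>x / 0 = 0\<close>.
\<close>

fun bspline :: "real list \<Rightarrow> nat \<Rightarrow> nat \<Rightarrow> real \<Rightarrow> real" where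
  "bspline ts 0 i x = (if ts ! i \<le> x \<and> x < ts ! (i + 1) then 1 else 0)"
| "bspline ts (Suc n) i x =
     (x - ts ! i) / (ts ! (i + Suc n) - ts ! i) * bspline ts n i x +
     (ts ! (i + Suc n + 1) - x) / (ts ! (i + Suc n + 1) - ts ! (i + 1)) * bspline ts n (i + 1) x"

text \<open>The given knots \<open>t\<^sub>-\<^sub>1 < t\<^sub>0 < \<dots> < t\<^sub>m\<^sub>+\<^sub>6\<close> are the values of \<open>t :: int \<Rightarrow> real\<close> on
  \<open>{-1..m+6}\<close>; other values of \<open>t\<close> are never used.\<close>

definition knot_diff :: "(int \<Rightarrow> real) \<Rightarrow> int \<Rightarrow> real" where
  "knot_diff t k = t k - t (k - 1)"

definition repeat_knots :: "nat \<Rightarrow> (int \<Rightarrow> real) \<Rightarrow> int list \<Rightarrow> real list" where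
  "repeat_knots a t js = concat (map (\<lambda>j. replicate a (t j)) js)"

definition mu_knots :: "nat \<Rightarrow> (int \<Rightarrow> real) \<Rightarrow> real list" where
  "mu_knots m t = map t [0..int m + 5]"

definition nu_knots :: "nat \<Rightarrow> (int \<Rightarrow> real) \<Rightarrow> real list" where
  "nu_knots m t = repeat_knots 3 t [0..int m + 5]"

definition rho_knots :: "nat \<Rightarrow> (int \<Rightarrow> real) \<Rightarrow> real list" where
  "rho_knots m t = [t (-1)] @ repeat_knots 3 t [0..int m + 5] @ [t (int m + 6)]"

definition tau_knots :: "nat \<Rightarrow> (int \<Rightarrow> real) \<Rightarrow> real list" where
  "tau_knots m t =
     replicate 5 (t (-1)) @ repeat_knots 8 t [0..int m + 5] @ replicate 5 (t (int m + 6))"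

definition preimage_curve :: "nat \<Rightarrow> (int \<Rightarrow> real) \<Rightarrow> (nat \<Rightarrow> complex) \<Rightarrow> real \<Rightarrow> complex" where
  "preimage_curve m t z x = (\<Sum>i\<le>m+2. z i * bspline (mu_knots m t) 2 i x)"

definition ph_curve :: "nat \<Rightarrow> (int \<Rightarrow> real) \<Rightarrow> (nat \<Rightarrow> complex) \<Rightarrow> real \<Rightarrow> complex" where
  "ph_curve m t r x = (\<Sum>i\<le>3*m+13. r i * bspline (rho_knots m t) 5 i x)"

definition offset_curve :: "real set \<Rightarrow> (real \<Rightarrow> complex) \<Rightarrow> real \<Rightarrow> real \<Rightarrow> complex" where
  "offset_curve I c h x =
     c x - \<i> * h * (vector_derivative c (at x within I) / norm (vector_derivative c (at x within I)))"

definition coeff_E :: "(int \<Rightarrow> real) \<Rightarrow> nat \<Rightarrow> real" where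
  "coeff_E t k = knot_diff t (int k + 1) + knot_diff t (int k + 2)"

definition coeff_S :: "(int \<Rightarrow> real) \<Rightarrow> (nat \<Rightarrow> real) \<Rightarrow> nat \<Rightarrow> real" where
  "coeff_S t \<sigma> k =
     (\<sigma> (3*k+2) * knot_diff t (int k + 1) + \<sigma> (3*k+1) * knot_diff t (int k + 2)) / coeff_E t k"

definition coeff_P :: "(int \<Rightarrow> real) \<Rightarrow> (nat \<Rightarrow> complex) \<Rightarrow> nat \<Rightarrow> complex" where
  "coeff_P t p k =
     (p (3*k+2) * knot_diff t (int k + 1) + p (3*k+1) * knot_diff t (int k + 2)) / coeff_E t k"
  for p :: "nat \<Rightarrow> complex"

definition coeff_U :: "(int \<Rightarrow> real) \<Rightarrow> (nat \<Rightarrow> complex) \<Rightarrow> nat \<Rightarrow> complex" where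
  "coeff_U t r k =
     (r (3*k+2) * knot_diff t (int k + 1) + r (3*k+1) * knot_diff t (int k + 2)) / coeff_E t k"
  for r :: "nat \<Rightarrow> complex"

definition coeff_V :: "(int \<Rightarrow> real) \<Rightarrow> (nat \<Rightarrow> complex) \<Rightarrow> nat \<Rightarrow> complex" where
  "coeff_V t r k =
     (r (3*k+3) * knot_diff t (int k + 1) + r (3*k+2) * knot_diff t (int k + 2)) / coeff_E t k"
  for r :: "nat \<Rightarrow> complex"

definition coeff_Q :: "(int \<Rightarrow> real) \<Rightarrow> (nat \<Rightarrow> complex) \<Rightarrow> nat \<Rightarrow> complex" where
  "coeff_Q t r k =
     (r (3*k+3) * (knot_diff t (int k + 1))^2
      + 2 * r (3*k+2) * knot_diff t (int k + 1) * knot_diff t (int k + 2)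
      + r (3*k+1) * (knot_diff t (int k + 2))^2) / (coeff_E t k)^2"
  for r :: "nat \<Rightarrow> complex"

text \<open>The factors \<open>\<lambda>\<^sub>7, \<dots>, \<lambda>\<^sub>1\<^sub>0\<close> and \<open>\<lambda>'\<^sub>3\<^sub>7, \<dots>, \<lambda>'\<^sub>4\<^sub>0\<close>, as functions of the subscript.\<close>

definition head_factor :: "(int \<Rightarrow> real) \<Rightarrow> nat \<Rightarrow> real" where
  "head_factor t k =
     (let d = knot_diff t in
      [1/126 * (d 0 / (d 0 + d 1))^2 * (d 1 / (d 1 + d 2)),
       5/126 * (d 0 / (d 0 + d 1)) * (d 1 / (d 1 + d 2)),
       5/42 * (d 1 / (d 1 + d 2)),
       5/18 * (d 1 / (d 1 + d 2))] ! (k - 7))"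

definition tail_factor :: "nat \<Rightarrow> (int \<Rightarrow> real) \<Rightarrow> nat \<Rightarrow> real" where
  "tail_factor m t j =
     (let d4 = knot_diff t (int m + 4); d5 = knot_diff t (int m + 5); d6 = knot_diff t (int m + 6) in
      [5/18 * (d5 / (d4 + d5)),
       5/42 * (d5 / (d4 + d5)),
       5/126 * (d6 / (d5 + d6)) * (d5 / (d4 + d5)),
       1/126 * (d6 / (d5 + d6))^2 * (d5 / (d4 + d5))] ! (j - 37))"

text \<open>
  The entries of the \<open>k\<close>-th block below are the formulas for the indices
  \<open>8k+11, 8k+12, \<dots>, 8k+18\<close>. The blocks \<open>0, \<dots>, m+2\<close> are used completely; of the block \<open>m+3\<close> only
  the first two entries (indices \<open>8m+35\<close> and \<open>8m+36\<close>) are used.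
\<close>

definition weight_block :: "(int \<Rightarrow> real) \<Rightarrow> (nat \<Rightarrow> real) \<Rightarrow> nat \<Rightarrow> real list" where
  "weight_block t \<sigma> k =
     (let S = coeff_S t \<sigma> in
      [4/9 * \<sigma> (3*k+1) + 5/9 * S k,
       5/9 * S k + 4/9 * \<sigma> (3*k+2),
       5/18 * S k + 5/9 * \<sigma> (3*k+2) + 1/6 * \<sigma> (3*k+3),
       5/42 * S k + 10/21 * \<sigma> (3*k+2) + 5/14 * \<sigma> (3*k+3) + 1/21 * \<sigma> (3*k+4),
       5/126 * S k + 20/63 * \<sigma> (3*k+2) + 10/21 * \<sigma> (3*k+3) + 10/63 * \<sigma> (3*k+4)
         + 1/126 * S (k+1),
       1/126 * S k + 10/63 * \<sigma> (3*k+2) + 10/21 * \<sigma> (3*k+3) + 20/63 * \<sigma> (3*k+4)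
         + 5/126 * S (k+1),
       1/21 * \<sigma> (3*k+2) + 5/14 * \<sigma> (3*k+3) + 10/21 * \<sigma> (3*k+4) + 5/42 * S (k+1),
       1/6 * \<sigma> (3*k+3) + 5/9 * \<sigma> (3*k+4) + 5/18 * S (k+1)])"

definition point_block ::
  "(int \<Rightarrow> real) \<Rightarrow> (nat \<Rightarrow> real) \<Rightarrow> (nat \<Rightarrow> complex) \<Rightarrow> (nat \<Rightarrow> complex) \<Rightarrow> real \<Rightarrow> nat \<Rightarrow> complex list"
where
  "point_block t \<sigma> p r h k =
     (let S = coeff_S t \<sigma>; P = coeff_P t p; U = coeff_U t r; V = coeff_V t r; Q = coeff_Q t r in
      [4/9 * Q k * \<sigma> (3*k+1) + 5/9 * U k * S k
         - \<i> * h * (4/9 * p (3*k+1) + 5/9 * P k),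
       5/9 * V k * S k + 4/9 * Q k * \<sigma> (3*k+2)
         - \<i> * h * (4/9 * p (3*k+2) + 5/9 * P k),
       5/18 * r (3*k+3) * S k + 5/9 * V k * \<sigma> (3*k+2) + 1/6 * Q k * \<sigma> (3*k+3)
         - \<i> * h * (1/6 * p (3*k+3) + 5/9 * p (3*k+2) + 5/18 * P k),
       5/42 * r (3*k+4) * S k + 10/21 * r (3*k+3) * \<sigma> (3*k+2) + 5/14 * V k * \<sigma> (3*k+3)
         + 1/21 * Q k * \<sigma> (3*k+4)
         - \<i> * h * (1/21 * p (3*k+4) + 5/14 * p (3*k+3) + 10/21 * p (3*k+2) + 5/42 * P k),
       5/126 * U (k+1) * S k + 20/63 * r (3*k+4) * \<sigma> (3*k+2) + 10/21 * r (3*k+3) * \<sigma> (3*k+3)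
         + 10/63 * V k * \<sigma> (3*k+4) + 1/126 * Q k * S (k+1)
         - \<i> * h * (1/126 * P (k+1) + 10/63 * p (3*k+4) + 10/21 * p (3*k+3)
                     + 20/63 * p (3*k+2) + 5/126 * P k),
       1/126 * Q (k+1) * S k + 10/63 * U (k+1) * \<sigma> (3*k+2) + 10/21 * r (3*k+4) * \<sigma> (3*k+3)
         + 20/63 * r (3*k+3) * \<sigma> (3*k+4) + 5/126 * V k * S (k+1)
         - \<i> * h * (5/126 * P (k+1) + 20/63 * p (3*k+4) + 10/21 * p (3*k+3)
                     + 10/63 * p (3*k+2) + 1/126 * P k),
       1/21 * Q (k+1) * \<sigma> (3*k+2) + 5/14 * U (k+1) * \<sigma> (3*k+3) + 10/21 * r (3*k+4) * \<sigma> (3*k+4)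
         + 5/42 * r (3*k+3) * S (k+1)
         - \<i> * h * (5/42 * P (k+1) + 10/21 * p (3*k+4) + 5/14 * p (3*k+3) + 1/21 * p (3*k+2)),
       1/6 * Q (k+1) * \<sigma> (3*k+3) + 5/9 * U (k+1) * \<sigma> (3*k+4) + 5/18 * r (3*k+4) * S (k+1)
         - \<i> * h * (5/18 * P (k+1) + 5/9 * p (3*k+4) + 1/6 * p (3*k+3))])"
  for \<sigma> :: "nat \<Rightarrow> real" and p r :: "nat \<Rightarrow> complex" and h :: real

definition offset_weight :: "nat \<Rightarrow> (int \<Rightarrow> real) \<Rightarrow> (nat \<Rightarrow> real) \<Rightarrow> nat \<Rightarrow> real" where
  "offset_weight m t \<sigma> k =
     (if k \<le> 6 \<or> 8*m+41 \<le> k then 0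
      else if k \<le> 10 then head_factor t k * \<sigma> 2
      else if 8*m+37 \<le> k then tail_factor m t (k - 8*m) * \<sigma> (3*m+10)
      else weight_block t \<sigma> ((k - 11) div 8) ! ((k - 11) mod 8))"

definition offset_point ::
  "nat \<Rightarrow> (int \<Rightarrow> real) \<Rightarrow> (nat \<Rightarrow> real) \<Rightarrow> (nat \<Rightarrow> complex) \<Rightarrow> (nat \<Rightarrow> complex) \<Rightarrow> real
    \<Rightarrow> nat \<Rightarrow> complex"
where
  "offset_point m t \<sigma> p r h k =
     (if k \<le> 6 \<or> 8*m+41 \<le> k then 0
      else if k \<le> 9 then head_factor t k * (r 0 * \<sigma> 2 - \<i> * h * p 2)
      else if k = 10 then head_factor t k * (r 1 * \<sigma> 2 - \<i> * h * p 2)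
      else if k = 8*m+37 then
        tail_factor m t (k - 8*m) * (r (3*m+12) * \<sigma> (3*m+10) - \<i> * h * p (3*m+10))
      else if 8*m+38 \<le> k then
        tail_factor m t (k - 8*m) * (r (3*m+13) * \<sigma> (3*m+10) - \<i> * h * p (3*m+10))
      else point_block t \<sigma> p r h ((k - 11) div 8) ! ((k - 11) mod 8))"
  for \<sigma> :: "nat \<Rightarrow> real" and p r :: "nat \<Rightarrow> complex" and h :: real

end

(*
  On a knot span [t_(k+1), t_(k+2)) with 1 <= k <= m+2 every B-spline sum is a polynomial, and one
  de Boor step (two for r) shows its Bezier points: Q_k, V_k, r_(3k+3), r_(3k+4), U_(k+1), Q_(k+1)
  for r; S_k, sigma_(3k+2), sigma_(3k+3), sigma_(3k+4), S_(k+1) for |r'|; and the same with P and p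
  for r'. Multiplying Bernstein forms of degrees 5 and 4, where r' is raised to degree 9 by the
  factor 1 of degree 5, gives the Bezier points of the two sums of degree 9. The head and tail
  formulas belong to B-splines that vanish on [t_2, t_(m+3)].
*)
theory Submission
  imports Defs
begin

section \<open>B-splines and Bernstein forms on a knot span\<close>

text \<open>The inner knots of \<open>nu\<close> and \<open>tau\<close> have multiplicity one less
  than the degree. Lowering the degree once makes both equal, and then the B-splines alive on a span
  are the Bernstein polynomials of that span. Triple knots in degree 5 require two such steps. The
  de Boor coefficients still depend on \<open>x\<close>; the Bezier points of full degree are found
  by recognising these coefficients as the intermediate points of a de Casteljau step. Multiplicity
  8 in degree 9 fits the smoothness of the product: a C^2 quintic spline times a C^1 quartic spline
  is C^1. Half-open spans cause two difficulties. The point t_(m+3) is the left end of the span with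
  k = m+2, which lies outside the interval, so the range of k is one longer than the interval
  suggests. And the derivative within the closed interval has to be computed on closed spans and
  then glued at the knots.\<close>

lemma bspline_eq_0:
  assumes "sorted ts" "i + n + 1 < length ts" "x < ts ! i \<or> ts ! (i + n + 1) \<le> x"
  shows "bspline ts n i x = 0"
  using assms(2,3)
proof (induction n arbitrary: i)
  case 0
  then show ?case by auto
next
  case (Suc n)
  have mono: "ts ! i \<le> ts ! (i + 1)" "ts ! (i + n + 1) \<le> ts ! (i + Suc n + 1)"
    using Suc.prems(1) assms(1) by (simp_all add: sorted_nth_mono)
  have "bspline ts n i x = 0"
    using Suc.prems mono by (intro Suc.IH) linarith+
  moreover have "bspline ts n (i + 1) x = 0"
    using Suc.prems mono by (intro Suc.IH) (auto simp: add.commute)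
  ultimately show ?case by simp
qed

lemma bspline_sum_local:
  fixes c :: "nat \<Rightarrow> 'a::real_field"
  assumes "sorted ts" "K + n + 1 < length ts" "s + n \<le> K"
    and "ts ! (s + n) \<le> x" "x < ts ! (s + n + 1)"
  shows "(\<Sum>k\<le>K. c k * of_real (bspline ts n k x))
           = (\<Sum>i\<le>n. c (s + i) * of_real (bspline ts n (s + i) x))"
proof -
  have vanish: "bspline ts n k x = 0" if "k \<le> K" "k \<notin> {s..s + n}" for k
  proof (rule bspline_eq_0[OF assms(1)])
    show "k + n + 1 < length ts" using that assms(2) by simp
    show "x < ts ! k \<or> ts ! (k + n + 1) \<le> x"
    proof (cases "k < s")
      case True
      then have "ts ! (k + n + 1) \<le> ts ! (s + n)"
        using assms by (intro sorted_nth_mono) auto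
      then show ?thesis using assms(4) by simp
    next
      case False
      then have "ts ! (s + n + 1) \<le> ts ! k"
        using assms that by (intro sorted_nth_mono) auto
      then show ?thesis using assms(5) by simp
    qed
  qed
  have "(\<Sum>k\<le>K. c k * of_real (bspline ts n k x))
          = (\<Sum>k\<in>{s..s + n}. c k * of_real (bspline ts n k x))"
    using assms(3) vanish by (intro sum.mono_neutral_right) auto
  also have "\<dots> = (\<Sum>i\<in>{0..n}. c (s + i) * of_real (bspline ts n (s + i) x))"
    using sum.shift_bounds_cl_nat_ivl[of "\<lambda>k. c k * of_real (bspline ts n k x)" 0 s n]
    by (simp add: add.commute)
  finally show ?thesis by (simp add: atLeast0AtMost)
qed

text \<open>Splitting every B-spline by its recursion and shifting one half of the sum pairs the
  terms with the same B-spline of lower degree. The two unpaired terms have the indices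
  \<open>s\<close> and \<open>s + n + 2\<close>; their supports end where the span begins and begin
  where it ends.\<close>

lemma de_boor_step:
  fixes c :: "nat \<Rightarrow> 'a::real_field"
  assumes "sorted ts" "s + 2 * n + 3 < length ts"
    and "ts ! (s + n + 1) \<le> x" "x < ts ! (s + n + 2)"
  shows "(\<Sum>i\<le>Suc n. c i * of_real (bspline ts (Suc n) (s + i) x))
           = (\<Sum>i\<le>n. (of_real ((x - ts ! (s + 1 + i)) / (ts ! (s + n + 2 + i) - ts ! (s + 1 + i))) * c (i + 1)
                 + of_real ((ts ! (s + n + 2 + i) - x) / (ts ! (s + n + 2 + i) - ts ! (s + 1 + i))) * c i)
               * of_real (bspline ts n (s + 1 + i) x))"
proof -
  define f where "f i = (x - ts ! (s + i)) / (ts ! (s + i + Suc n) - ts ! (s + i)) * bspline ts n (s + i) x" for i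
  define g where "g i = (ts ! (s + i + Suc n + 1) - x) / (ts ! (s + i + Suc n + 1) - ts ! (s + i + 1))
                           * bspline ts n (s + i + 1) x" for i
  have z0: "bspline ts n s x = 0"
    using assms(2,3) by (intro bspline_eq_0[OF assms(1)] disjI2) simp_all
  have fg: "bspline ts (Suc n) (s + i) x = f i + g i" for i
    by (simp add: f_def g_def)
  have "bspline ts n (s + n + 2) x = 0"
    using assms(2,4) by (intro bspline_eq_0[OF assms(1)] disjI1) simp_all
  then have z1: "bspline ts n (s + Suc n + 1) x = 0" by simp
  have "(\<Sum>i\<le>Suc n. c i * of_real (bspline ts (Suc n) (s + i) x))
          = (\<Sum>i\<le>Suc n. c i * of_real (f i)) + (\<Sum>i\<le>Suc n. c i * of_real (g i))"
    by (simp only: fg of_real_add distrib_left sum.distrib)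
  also have "(\<Sum>i\<le>Suc n. c i * of_real (f i)) = (\<Sum>i\<le>n. c (i + 1) * of_real (f (i + 1)))"
    by (subst sum.atMost_Suc_shift) (simp add: f_def z0)
  also have "(\<Sum>i\<le>Suc n. c i * of_real (g i)) = (\<Sum>i\<le>n. c i * of_real (g i))"
    using z1 by (simp add: g_def)
  also have "(\<Sum>i\<le>n. c (i + 1) * of_real (f (i + 1))) + (\<Sum>i\<le>n. c i * of_real (g i))
      = (\<Sum>i\<le>n. c (i + 1) * of_real (f (i + 1)) + c i * of_real (g i))"
    by (rule sum.distrib[symmetric])
  moreover have swap: "s + i + n = s + n + i" for i by simp
  ultimately show ?thesis
    by (simp add: f_def g_def distrib_right mult.assoc swap mult.left_commute[of "c _"] del: sum.atMost_Suc)
qed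

section \<open>Bernstein polynomials as B-splines of full knot multiplicity\<close>

lemma Bernstein_Suc_0: "Bernstein (Suc n) 0 u = (1 - u) * Bernstein n 0 u"
  by (simp add: Bernstein_def)

lemma Bernstein_Suc_Suc:
  "Bernstein (Suc n) (Suc i) u = u * Bernstein n i u + (1 - u) * Bernstein n (Suc i) u"
proof (cases "i < n")
  case True
  then have "n - i = Suc (n - Suc i)" by simp
  then show ?thesis by (simp add: Bernstein_def algebra_simps)
next
  case False
  then show ?thesis by (simp add: Bernstein_def binomial_eq_0)
qed

lemma Bernstein_eq_0: "n < i \<Longrightarrow> Bernstein n i u = 0"
  by (simp add: Bernstein_def)

text \<open>Here \<open>\<mu>\<close> is the position of the last knot equal to \<open>b\<close>.
  Once all knots that matter are \<open>b\<close> or \<open>c\<close>, the B-spline recursion is the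
  Bernstein recursion. Multiplicity \<open>M\<close> suffices up to degree \<open>M\<close>,
  although the extreme B-splines of degree \<open>M\<close> reach one knot further: that knot occurs
  only in terms whose lower-degree B-spline vanishes on the span.\<close>

lemma bspline_eq_Bernstein:
  assumes "sorted ts" "M \<le> \<mu> + 1" "\<mu> + M + 1 < length ts"
    and left: "\<And>k. k < M \<Longrightarrow> ts ! (\<mu> - k) = b"
    and right: "\<And>k. k < M \<Longrightarrow> ts ! (\<mu> + 1 + k) = c"
    and "b \<le> x" "x < c" "0 < M" "n \<le> M" "n \<le> \<mu>" "i \<le> n"
  shows "bspline ts n (\<mu> - n + i) x = Bernstein n i ((x - b) / (c - b))"
  using assms(9-11)
proof (induction n arbitrary: i)
  case 0
  then show ?case using left[of 0] right[of 0] assms(6-8) by (simp add: Bernstein_def)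
next
  case (Suc n)
  define u where "u = (x - b) / (c - b)"
  have u': "(c - x) / (c - b) = 1 - u" using assms(6,7) by (simp add: u_def field_simps)
  let ?s = "\<mu> - Suc n"
  have \<mu>: "\<mu> = ?s + Suc n" using Suc.prems by simp
  have first: "(x - ts ! (?s + i)) / (ts ! (?s + i + Suc n) - ts ! (?s + i)) * bspline ts n (?s + i) x
     = (if i = 0 then 0 else u * Bernstein n (i - 1) u)"
  proof (cases "i = 0")
    case True
    have "bspline ts n ?s x = 0"
      using assms left[of 0] Suc.prems by (intro bspline_eq_0) (auto simp flip: \<mu>)
    then show ?thesis using True by simp
  next
    case False
    have "bspline ts n (?s + i) x = Bernstein n (i - 1) u"
      using Suc.IH[of "i - 1"] Suc.prems False by (simp add: u_def Suc_diff_Suc)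
    moreover have "ts ! (?s + i) = b"
      using left[of "Suc n - i"] Suc.prems False by (simp add: Suc_diff_le)
    moreover have "ts ! (?s + i + Suc n) = c"
      using right[of "i - 1"] Suc.prems False by (simp add: ac_simps)
    ultimately show ?thesis using False by (simp add: u_def)
  qed
  have second: "(ts ! (?s + i + Suc n + 1) - x) / (ts ! (?s + i + Suc n + 1) - ts ! (?s + i + 1))
       * bspline ts n (?s + i + 1) x = (1 - u) * Bernstein n i u"
  proof (cases "i = Suc n")
    case True
    have "bspline ts n (?s + i + 1) x = 0"
      using assms right[of 0] Suc.prems True by (intro bspline_eq_0) auto
    then show ?thesis using True by (simp add: Bernstein_eq_0)
  next
    case False
    have "bspline ts n (?s + i + 1) x = Bernstein n i u"
      using Suc.IH[of i] Suc.prems False by (simp add: u_def Suc_diff_Suc)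
    moreover have "ts ! (?s + i + 1) = b"
      using left[of "n - i"] Suc.prems False by (simp add: Suc_diff_le Suc_diff_Suc)
    moreover have "ts ! (?s + i + Suc n + 1) = c"
      using right[of i] Suc.prems False by (simp add: ac_simps)
    ultimately show ?thesis by (simp add: u')
  qed
  show ?case
    unfolding bspline.simps first second using Suc.prems
    by (cases i) (simp_all add: Bernstein_Suc_0 Bernstein_Suc_Suc u_def)
qed

section \<open>Polynomials in Bernstein form: de Casteljau step, product, derivative\<close>

definition bezier :: "nat \<Rightarrow> (nat \<Rightarrow> 'a::real_field) \<Rightarrow> real \<Rightarrow> 'a" where
  "bezier n b u = (\<Sum>i\<le>n. b i * of_real (Bernstein n i u))"

lemma bezier_cong: "(\<And>i. i \<le> n \<Longrightarrow> a i = b i) \<Longrightarrow> bezier n a u = bezier n b u"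
  by (simp add: bezier_def)

text \<open>De Casteljau's step. Read from right to left it turns a form whose points are affine in
  \<open>u\<close> into a form with constant points, one degree higher; the conversions of B-spline
  sums rest on this direction.\<close>

lemma bezier_Suc: "bezier (Suc n) b u = bezier n (\<lambda>i. of_real (1 - u) * b i + of_real u * b (Suc i)) u"
proof -
  have "bezier (Suc n) b u = of_real (1 - u) * (\<Sum>i\<le>Suc n. b i * of_real (Bernstein n i u))
      + of_real u * (\<Sum>i\<le>n. b (Suc i) * of_real (Bernstein n i u))"
    unfolding bezier_def sum.atMost_Suc_shift
    by (simp add: Bernstein_Suc_0 Bernstein_Suc_Suc distrib_left sum.distrib sum_distrib_left mult.left_commute mult.assoc add.commute add.left_commute)
  also have "(\<Sum>i\<le>Suc n. b i * of_real (Bernstein n i u)) = (\<Sum>i\<le>n. b i * of_real (Bernstein n i u))"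
    by (simp add: Bernstein_eq_0)
  finally show ?thesis
    by (simp only: bezier_def distrib_right sum.distrib sum_distrib_left mult.assoc)
qed

lemma bezier_linear:
  "bezier n (\<lambda>i. x * a i + y * b i) u = x * bezier n a u + y * bezier n b u"
  by (simp add: bezier_def sum.distrib sum_distrib_left algebra_simps)

lemma bezier_0: "bezier n b 0 = b 0"
proof (induction n)
  case 0
  show ?case by (simp add: bezier_def Bernstein_def)
next
  case (Suc n)
  then show ?case by (simp add: bezier_Suc)
qed

lemma bezier_1: "bezier n b 1 = b n"
proof (induction n arbitrary: b)
  case 0
  show ?case by (simp add: bezier_def Bernstein_def)
next
  case (Suc n)
  then show ?case by (simp add: bezier_Suc)
qed

lemma bezier_const: "bezier n (\<lambda>_. c) u = c"
  using sum_Bernstein[of n u] by (simp add: bezier_def flip: sum_distrib_left of_real_sum)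

lemma bezier_mult:
  "bezier m a u * bezier n b u
     = bezier (m + n) (\<lambda>r. (\<Sum>k\<le>r. of_nat (m choose k) * of_nat (n choose (r - k)) * a k * b (r - k))
         / of_nat ((m + n) choose r)) u"
proof -
  define f g :: "nat \<Rightarrow> 'a" where "f k = a k * of_real (Bernstein m k u)" and "g k = b k * of_real (Bernstein n k u)" for k
  \<comment> \<open>The powers of 1 make both factors polynomials evaluated at 1, so that
    \<open>polynomial_product\<close> regroups the double sum by the total index.\<close>
  have "bezier m a u * bezier n b u = (\<Sum>i\<le>m. f i * 1 ^ i) * (\<Sum>i\<le>n. g i * 1 ^ i)"
    by (simp add: bezier_def f_def g_def)
  also have "\<dots> = (\<Sum>r\<le>m + n. (\<Sum>k\<le>r. f k * g (r - k)) * 1 ^ r)"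
    by (rule polynomial_product) (simp_all add: f_def g_def Bernstein_eq_0)
  also have "\<dots> = (\<Sum>r\<le>m + n. (\<Sum>k\<le>r. of_nat (m choose k) * of_nat (n choose (r - k)) * a k * b (r - k))
      * of_real (u ^ r * (1 - u) ^ (m + n - r)))"
    unfolding sum_distrib_right
  proof (intro sum.cong refl)
    fix r k :: nat assume "k \<in> {..r}"
    then have k: "k \<le> r" by simp
    show "f k * g (r - k) * 1 ^ r = of_nat (m choose k) * of_nat (n choose (r - k)) * a k * b (r - k)
        * of_real (u ^ r * (1 - u) ^ (m + n - r))"
    proof (cases "k \<le> m \<and> r - k \<le> n")
      case True
      then have "m + n - r = (m - k) + (n - (r - k))" using k by arith
      moreover have "u ^ r = u ^ k * u ^ (r - k)" using k by (simp flip: power_add)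
      ultimately show ?thesis
        by (simp only: f_def g_def Bernstein_def power_add) (simp add: ac_simps)
    qed (auto simp: f_def g_def Bernstein_def)
  qed
  also have "\<dots> = bezier (m + n) (\<lambda>r. (\<Sum>k\<le>r. of_nat (m choose k) * of_nat (n choose (r - k)) * a k * b (r - k))
         / of_nat ((m + n) choose r)) u"
    unfolding bezier_def by (intro sum.cong refl) (simp add: Bernstein_def)
  finally show ?thesis .
qed

text \<open>The product rule is applied to the de Casteljau step. Differentiating its weights gives
  one copy of the form with the difference points, differentiating the two smaller forms gives
  \<open>Suc n\<close> further copies.\<close>

lemma bezier_has_vector_derivative:
  fixes b :: "nat \<Rightarrow> 'a::real_normed_field"
  shows "(bezier (Suc n) b has_vector_derivative of_nat (Suc n) * bezier n (\<lambda>i. b (Suc i) - b i) u) (at u within A)"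
proof (induction n arbitrary: b)
  case 0
  have "bezier (Suc 0) b = (\<lambda>u. of_real (1 - u) * b 0 + of_real u * b 1)"
    by (simp add: fun_eq_iff bezier_def Bernstein_def)
  then show ?case
    by (auto intro!: derivative_eq_intros simp: bezier_def Bernstein_def scaleR_conv_of_real)
next
  case (Suc n)
  let ?c = "\<lambda>i. b (Suc i)" and ?\<Delta> = "\<lambda>i. b (Suc i) - b i"
  have split: "bezier (Suc (Suc n)) b
      = (\<lambda>u. of_real (1 - u) * bezier (Suc n) b u + of_real u * bezier (Suc n) ?c u)"
    by (simp only: fun_eq_iff bezier_linear[symmetric] bezier_Suc[of "Suc n"] simp_thms)
  have deriv: "(bezier (Suc (Suc n)) b has_vector_derivative
      (of_real (1 - u) * (of_nat (Suc n) * bezier n ?\<Delta> u) - bezier (Suc n) b u)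
      + (of_real u * (of_nat (Suc n) * bezier n (\<lambda>i. ?c (Suc i) - ?c i) u) + bezier (Suc n) ?c u)) (at u within A)"
    unfolding split by (auto intro!: derivative_eq_intros Suc simp: scaleR_conv_of_real)
  have eq1: "bezier (Suc n) ?\<Delta> u = bezier (Suc n) ?c u - bezier (Suc n) b u"
    using bezier_linear[of "Suc n" 1 ?c "-1" b u] by simp
  have eq2: "bezier (Suc n) ?\<Delta> u = of_real (1 - u) * bezier n ?\<Delta> u
      + of_real u * bezier n (\<lambda>i. ?c (Suc i) - ?c i) u"
    by (simp only: bezier_linear[symmetric] bezier_Suc[of n])
  have "of_nat (Suc (Suc n)) * bezier (Suc n) ?\<Delta> u
      = of_nat (Suc n) * bezier (Suc n) ?\<Delta> u + bezier (Suc n) ?\<Delta> u"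
    by (simp add: distrib_right)
  also have "\<dots> = of_nat (Suc n) * (of_real (1 - u) * bezier n ?\<Delta> u
      + of_real u * bezier n (\<lambda>i. ?c (Suc i) - ?c i) u) + (bezier (Suc n) ?c u - bezier (Suc n) b u)"
    by (metis eq1 eq2)
  also have "\<dots> = (of_real (1 - u) * (of_nat (Suc n) * bezier n ?\<Delta> u) - bezier (Suc n) b u)
      + (of_real u * (of_nat (Suc n) * bezier n (\<lambda>i. ?c (Suc i) - ?c i) u) + bezier (Suc n) ?c u)"
    by (simp only: distrib_left mult.left_commute add.assoc diff_conv_add_uminus add.left_commute add.commute)
  finally show ?case using deriv by simp
qed

section \<open>From B-spline sums to Bezier points on one span\<close>

text \<open>After one de Boor step the B-splines are Bernstein polynomials of degree
  \<open>M\<close>. The inner coefficients already have de Casteljau form. The two outer ones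
  involve the neighbouring knots \<open>a\<close> and \<open>e\<close>; being affine in
  \<open>x\<close>, they are rewritten through their values at \<open>b\<close> and
  \<open>c\<close>, which yields the two mixed end points.\<close>

lemma bspline_sum_bezier:
  fixes C :: "nat \<Rightarrow> 'a::real_field"
  assumes "sorted ts" "2 \<le> M" "s + 2 * M + 3 < length ts"
    and a: "ts ! (s + 1) = a" and b: "\<And>i. i < M \<Longrightarrow> ts ! (s + 2 + i) = b"
    and c: "\<And>i. i < M \<Longrightarrow> ts ! (s + M + 2 + i) = c" and e: "ts ! (s + 2 * M + 2) = e"
    and x: "b \<le> x" "x < c"
  shows "(\<Sum>i\<le>Suc M. C i * of_real (bspline ts (Suc M) (s + i) x))
    = bezier (Suc M) (\<lambda>i. if i = 0 then of_real ((c - b) / (c - a)) * C 0 + of_real ((b - a) / (c - a)) * C 1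
        else if i = Suc M then of_real ((e - c) / (e - b)) * C M + of_real ((c - b) / (e - b)) * C (Suc M)
        else C i) ((x - b) / (c - b))"
    (is "_ = bezier _ ?B ?u")
proof -
  have "ts ! (s + 1) \<le> ts ! (s + 2 + 0)" "ts ! (s + M + 2 + (M - 1)) \<le> ts ! (s + 2 * M + 2)"
    using assms(2,3) by (intro sorted_nth_mono[OF assms(1)]; simp)+
  then have ord: "a \<le> b" "b < c" "c \<le> e"
    using assms(2) a b[of 0] c[of "M - 1"] e x by simp_all
  have last_b: "ts ! (s + M + 1) = b" and first_c: "ts ! (s + M + 2) = c"
    using assms(2) b[of "M - 1"] c[of 0] by simp_all
  have lin0: "(x - a) / (c - a) = (1 - ?u) * ((b - a) / (c - a)) + ?u"
      "(c - x) / (c - a) = (1 - ?u) * ((c - b) / (c - a))"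
    and lin: "(c - x) / (c - b) = 1 - ?u"
    and lin1: "(x - b) / (e - b) = ?u * ((c - b) / (e - b))"
      "(e - x) / (e - b) = (1 - ?u) + ?u * ((e - c) / (e - b))"
    using ord by (simp_all add: divide_simps) (simp_all add: algebra_simps)
  have base: "bspline ts M (s + 1 + i) x = Bernstein M i ?u" if "i \<le> M" for i
  proof -
    have "ts ! (s + M + 1 - j) = b" if "j < M" for j
      using b[of "M - 1 - j"] that by (simp add: Suc_diff_Suc Suc_diff_le)
    moreover have "ts ! (s + M + 1 + 1 + j) = c" if "j < M" for j
      using c[of j] that by simp
    ultimately have "bspline ts M (s + M + 1 - M + i) x = Bernstein M i ?u"
      using assms that by (intro bspline_eq_Bernstein[where M = M and \<mu> = "s + M + 1"]) auto
    then show ?thesis by simp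
  qed
  have coeff: "of_real ((x - ts ! (s + 1 + i)) / (ts ! (s + M + 2 + i) - ts ! (s + 1 + i))) * C (i + 1)
      + of_real ((ts ! (s + M + 2 + i) - x) / (ts ! (s + M + 2 + i) - ts ! (s + 1 + i))) * C i
      = of_real (1 - ?u) * ?B i + of_real ?u * ?B (Suc i)" if i: "i \<le> M" for i
  proof -
    consider "i = 0" | "0 < i" "i < M" | "i = M" using i by linarith
    then show ?thesis
    proof cases
      case 1
      then have k: "ts ! (s + 1 + i) = a" "ts ! (s + M + 2 + i) = c" using a first_c by simp_all
      show ?thesis unfolding k lin0 of_real_mult of_real_add using 1 assms(2)
        by (simp add: distrib_left distrib_right mult.assoc add_ac del: of_real_divide of_real_diff)
    next
      case 2
      then have k: "ts ! (s + 1 + i) = b" "ts ! (s + M + 2 + i) = c" using b[of "i - 1"] c[of i] by simp_all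
      show ?thesis unfolding k lin using 2 by (simp add: algebra_simps del: of_real_divide)
    next
      case 3
      then have k: "ts ! (s + 1 + i) = b" "ts ! (s + M + 2 + i) = e" using last_b e by (simp_all add: mult_2 add_ac)
      show ?thesis unfolding k lin1 of_real_mult of_real_add using 3 assms(2)
        by (simp add: distrib_left distrib_right mult.assoc add_ac del: of_real_divide of_real_diff)
    qed
  qed
  have "(\<Sum>i\<le>Suc M. C i * of_real (bspline ts (Suc M) (s + i) x))
      = (\<Sum>i\<le>M. (of_real (1 - ?u) * ?B i + of_real ?u * ?B (Suc i)) * of_real (Bernstein M i ?u))"
    unfolding de_boor_step[OF assms(1,3), of x C, unfolded last_b first_c, OF x]
    by (intro sum.cong refl arg_cong2[of _ _ _ _ "(*)"] coeff arg_cong[of _ _ of_real] base) simp_all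
  then show ?thesis by (simp only: bezier_Suc) (simp only: bezier_def)
qed

text \<open>A first de Boor step leads to a quartic sum with the \<open>x\<close>-dependent
  coefficients \<open>C'\<close>. The preceding lemma speaks of one fixed \<open>x\<close>, so it
  applies to these coefficients as well. Its end points mix coefficients that are mixed already,
  hence the double mixing in the outermost points.\<close>

lemma bspline_quintic_sum_bezier:
  fixes C :: "nat \<Rightarrow> 'a::real_field"
  assumes "sorted ts" "s + 11 < length ts"
    and a: "ts ! (s + 1) = a" "ts ! (s + 2) = a"
    and b: "ts ! (s + 3) = b" "ts ! (s + 4) = b" "ts ! (s + 5) = b"
    and c: "ts ! (s + 6) = c" "ts ! (s + 7) = c" "ts ! (s + 8) = c"
    and e: "ts ! (s + 9) = e" "ts ! (s + 10) = e"
    and x: "b \<le> x" "x < c"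
    and \<kappa>: "\<kappa> = of_real ((c - b) / (c - a))" "\<kappa>' = of_real ((b - a) / (c - a))"
    and \<theta>: "\<theta> = of_real ((e - c) / (e - b))" "\<theta>' = of_real ((c - b) / (e - b))"
  shows "(\<Sum>i\<le>5. C i * of_real (bspline ts 5 (s + i) x))
    = bezier 5 ((!) [\<kappa> * (\<kappa> * C 0 + \<kappa>' * C 1) + \<kappa>' * (\<kappa> * C 1 + \<kappa>' * C 2), \<kappa> * C 1 + \<kappa>' * C 2,
        C 2, C 3, \<theta> * C 3 + \<theta>' * C 4, \<theta> * (\<theta> * C 3 + \<theta>' * C 4) + \<theta>' * (\<theta> * C 4 + \<theta>' * C 5)])
        ((x - b) / (c - b))"
    (is "_ = bezier _ ?B ?u")
proof -
  have "ts ! (s + 2) \<le> ts ! (s + 3)" "ts ! (s + 8) \<le> ts ! (s + 9)"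
    using assms(2) by (intro sorted_nth_mono[OF assms(1)]; simp)+
  then have ord: "a \<le> b" "b < c" "c \<le> e" using a b c e x by simp_all
  define C' where "C' i = of_real ((x - ts ! (s + 1 + i)) / (ts ! (s + 6 + i) - ts ! (s + 1 + i))) * C (i + 1)
      + of_real ((ts ! (s + 6 + i) - x) / (ts ! (s + 6 + i) - ts ! (s + 1 + i))) * C i" for i
  let ?D = "\<lambda>i. if i = 0 then \<kappa> * C' 0 + \<kappa>' * C' 1 else if i = 4 then \<theta> * C' 3 + \<theta>' * C' 4 else C' i"
  have "(\<Sum>i\<le>5. C i * of_real (bspline ts 5 (s + i) x)) = (\<Sum>i\<le>4. C' i * of_real (bspline ts 4 (s + 1 + i) x))"
    using de_boor_step[OF assms(1), of s 4 x C] assms(2) b c x by (simp add: C'_def ac_simps del: sum.atMost_Suc of_real_divide)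
  also have "\<dots> = bezier 4 ?D ?u"
  proof -
    have "ts ! (s + 1 + 2 + i) = b" "ts ! (s + 1 + 3 + 2 + i) = c" if "i < 3" for i
    proof -
      have "i = 0 \<or> i = 1 \<or> i = 2" using that by linarith
      then show "ts ! (s + 1 + 2 + i) = b" "ts ! (s + 1 + 3 + 2 + i) = c"
        using b c by (auto simp: numeral_eq_Suc)
    qed
    moreover have "Suc 3 = 4" by simp
    ultimately show ?thesis
      using bspline_sum_bezier[OF assms(1), of 3 "s + 1" a b c e x C', unfolded \<open>Suc 3 = 4\<close>] assms(2) a e x
      unfolding \<kappa> \<theta> by (simp add: ac_simps del: sum.atMost_Suc of_real_divide)
  qed
  \<comment> \<open>Every quartic point is affine in \<open>?u\<close>, with the value
    \<open>?B i\<close> at 0 and \<open>?B (Suc i)\<close> at 1.\<close>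
  also have "\<dots> = bezier 4 (\<lambda>i. of_real (1 - ?u) * ?B i + of_real ?u * ?B (Suc i)) ?u"
  proof (rule bezier_cong)
    have lin0: "(x - a) / (c - a) = (1 - ?u) * ((b - a) / (c - a)) + ?u"
        "(c - x) / (c - a) = (1 - ?u) * ((c - b) / (c - a))"
      and lin: "(c - x) / (c - b) = 1 - ?u"
      and lin1: "(x - b) / (e - b) = ?u * ((c - b) / (e - b))"
        "(e - x) / (e - b) = (1 - ?u) + ?u * ((e - c) / (e - b))"
      using ord by (simp_all add: divide_simps) (simp_all add: algebra_simps)
    have C': "C' 0 = (of_real (1 - ?u) * \<kappa>' + of_real ?u) * C 1 + of_real (1 - ?u) * \<kappa> * C 0"
      "C' 1 = (of_real (1 - ?u) * \<kappa>' + of_real ?u) * C 2 + of_real (1 - ?u) * \<kappa> * C 1"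
      "C' 2 = of_real ?u * C 3 + of_real (1 - ?u) * C 2"
      "C' 3 = of_real ?u * \<theta>' * C 4 + (of_real (1 - ?u) + of_real ?u * \<theta>) * C 3"
      "C' 4 = of_real ?u * \<theta>' * C 5 + (of_real (1 - ?u) + of_real ?u * \<theta>) * C 4"
      by (simp_all only: C'_def \<kappa> \<theta> lin0 lin lin1 a b c e add.assoc add_0_right add_0_left numeral_plus_numeral
          numeral_plus_one one_plus_numeral one_add_one add_num_simps of_real_mult of_real_add)
    fix i :: nat assume "i \<le> 4"
    then consider "i = 0" | "i = 1" | "i = 2" | "i = 3" | "i = 4" by linarith
    then show "?D i = of_real (1 - ?u) * ?B i + of_real ?u * ?B (Suc i)"
      by cases (simp_all add: C'[unfolded One_nat_def] algebra_simps del: of_real_divide)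
  qed
  also have "\<dots> = bezier 5 ?B ?u"
    using bezier_Suc[of 4 ?B ?u] by simp
  finally show ?thesis .
qed

text \<open>Origin of the rational constants in the weights and control points: the factor of
  \<open>a j * b l\<close> is (5 choose j) (4 choose l) / (9 choose (j + l)).\<close>

lemma bezier_mult_5_4:
  "bezier 5 a u * bezier 4 b u = bezier 9 ((!)
    [a 0 * b 0,
     4/9 * a 0 * b 1 + 5/9 * a 1 * b 0,
     5/18 * a 2 * b 0 + 5/9 * a 1 * b 1 + 1/6 * a 0 * b 2,
     5/42 * a 3 * b 0 + 10/21 * a 2 * b 1 + 5/14 * a 1 * b 2 + 1/21 * a 0 * b 3,
     5/126 * a 4 * b 0 + 20/63 * a 3 * b 1 + 10/21 * a 2 * b 2 + 10/63 * a 1 * b 3 + 1/126 * a 0 * b 4,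
     1/126 * a 5 * b 0 + 10/63 * a 4 * b 1 + 10/21 * a 3 * b 2 + 20/63 * a 2 * b 3 + 5/126 * a 1 * b 4,
     1/21 * a 5 * b 1 + 5/14 * a 4 * b 2 + 10/21 * a 3 * b 3 + 5/42 * a 2 * b 4,
     1/6 * a 5 * b 2 + 5/9 * a 4 * b 3 + 5/18 * a 3 * b 4,
     4/9 * a 5 * b 3 + 5/9 * a 4 * b 4,
     a 5 * b 4]) u"
    (is "_ = bezier 9 ((!) ?L) u")
proof -
  have choose5: "5 choose 2 = (10::nat)" "5 choose 3 = (10::nat)" "5 choose 4 = (5::nat)"
    and choose4: "4 choose 2 = (6::nat)" "4 choose 3 = (4::nat)"
    and choose9: "9 choose 2 = (36::nat)" "9 choose 3 = (84::nat)" "9 choose 4 = (126::nat)"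
      "9 choose 5 = (126::nat)" "9 choose 6 = (84::nat)" "9 choose 7 = (36::nat)" "9 choose 8 = (9::nat)"
    by (simp_all add: numeral_eq_Suc)
  have atMost: "{..(0::nat)} = {0}" "{..(1::nat)} = {0,1}" "{..(2::nat)} = {0,1,2}" "{..(3::nat)} = {0,1,2,3}"
    "{..(4::nat)} = {0,1,2,3,4}" "{..(5::nat)} = {0,1,2,3,4,5}" "{..(6::nat)} = {0,1,2,3,4,5,6}"
    "{..(7::nat)} = {0,1,2,3,4,5,6,7}" "{..(8::nat)} = {0,1,2,3,4,5,6,7,8}"
    "{..(9::nat)} = {0,1,2,3,4,5,6,7,8,9}" by auto
  show ?thesis
    unfolding bezier_mult
  proof (simp only: add_num_simps numeral_plus_numeral, rule bezier_cong)
    fix i :: nat assume "i \<le> 9"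
    then have "i \<in> {0,1,2,3,4,5,6,7,8,9}" unfolding atMost(10)[symmetric] by simp
    then show "(\<Sum>k\<le>i. of_nat (5 choose k) * of_nat (4 choose (i - k)) * a k * b (i - k)) / of_nat (9 choose i)
      = ?L ! i"
      by (elim insertE emptyE) (simp_all add: atMost choose5 choose4 choose9 binomial_eq_0 field_simps)
  qed
qed

section \<open>The knot sequences\<close>

lemma length_repeat_knots: "length (repeat_knots a t js) = a * length js"
  by (induction js) (simp_all add: repeat_knots_def)

lemma nth_repeat_knots: "i < a * length js \<Longrightarrow> repeat_knots a t js ! i = t (js ! (i div a))"
proof (induction js arbitrary: i)
  case (Cons j js)
  show ?case
  proof (cases "i < a")
    case True
    then show ?thesis by (simp add: repeat_knots_def nth_append)
  next
    case False
    have "a > 0" using Cons.prems by (cases a) auto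
    then have "i div a = Suc ((i - a) div a)" using False by (simp add: le_div_geq)
    then show ?thesis using Cons False by (simp add: repeat_knots_def nth_append)
  qed
qed simp

lemma sorted_repeat_knots: "sorted (map t js) \<Longrightarrow> sorted (repeat_knots a t js)"
  by (induction js) (auto simp: repeat_knots_def sorted_append sorted_replicate split: if_splits)

lemma set_repeat_knots: "set (repeat_knots a t js) \<subseteq> t ` set js"
  by (auto simp: repeat_knots_def)

locale increasing_knots =
  fixes m :: nat and t :: "int \<Rightarrow> real"
  assumes increasing: "\<And>k. k \<in> {-1..int m + 5} \<Longrightarrow> t k < t (k + 1)"
begin

lemma knot_strict: "-1 \<le> i \<Longrightarrow> i < j \<Longrightarrow> j \<le> int m + 6 \<Longrightarrow> t i < t j"
proof (induction "nat (j - i)" arbitrary: j)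
  case (Suc n)
  show ?case
  proof (cases "j = i + 1")
    case True
    then show ?thesis using increasing[of i] Suc.prems by simp
  next
    case False
    then have "t i < t (j - 1)" using Suc by (intro Suc.hyps) auto
    also have "t (j - 1) < t j" using increasing[of "j - 1"] Suc.prems by simp
    finally show ?thesis .
  qed
qed simp

lemma knot_mono: "-1 \<le> i \<Longrightarrow> i \<le> j \<Longrightarrow> j \<le> int m + 6 \<Longrightarrow> t i \<le> t j"
  using knot_strict[of i j] by (cases "i = j") auto

lemma sorted_inner_knots: "sorted (map t [0..int m + 5])"
  by (auto simp: sorted_iff_nth_mono intro!: knot_mono)

lemma sorted_nu: "sorted (nu_knots m t)"
  unfolding nu_knots_def by (rule sorted_repeat_knots[OF sorted_inner_knots])

lemma sorted_rho: "sorted (rho_knots m t)"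
  using set_repeat_knots[of 3 t "[0..int m + 5]"] sorted_repeat_knots[OF sorted_inner_knots, of 3]
  by (fastforce simp: rho_knots_def sorted_append intro!: knot_mono)

lemma sorted_tau: "sorted (tau_knots m t)"
  using set_repeat_knots[of 8 t "[0..int m + 5]"] sorted_repeat_knots[OF sorted_inner_knots, of 8]
  by (fastforce simp: tau_knots_def sorted_append sorted_replicate intro!: knot_mono)

end

lemma length_inner_knots: "length [0..int m + 5] = m + 6"
  by simp

lemma length_nu: "length (nu_knots m t) = 3 * m + 18"
  by (simp add: nu_knots_def length_repeat_knots)

lemma length_rho: "length (rho_knots m t) = 3 * m + 20"
  by (simp add: rho_knots_def length_repeat_knots)

lemma length_tau: "length (tau_knots m t) = 8 * m + 58"
  by (simp add: tau_knots_def length_repeat_knots)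

text \<open>\<open>j\<close> selects a group of equal knots and \<open>l\<close> a position inside
  it. The shifts by 1 and 5 in the analogues for \<open>rho_knots\<close> and
  \<open>tau_knots\<close> skip the leading copies of \<open>t (-1)\<close>.\<close>

lemma nth_nu: "i = 3 * j + l \<Longrightarrow> l < 3 \<Longrightarrow> j \<le> m + 5 \<Longrightarrow> nu_knots m t ! i = t (int j)"
  by (subst nu_knots_def, subst nth_repeat_knots) auto

lemma nth_rho:
  assumes "i = 3 * j + l + 1" "l < 3" "j \<le> m + 5"
  shows "rho_knots m t ! i = t (int j)"
proof -
  have "rho_knots m t ! i = repeat_knots 3 t [0..int m + 5] ! (3 * j + l)"
    using assms by (simp add: rho_knots_def nth_append length_repeat_knots length_inner_knots del: length_upto)
  also have "\<dots> = t (int j)" using assms by (subst nth_repeat_knots) auto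
  finally show ?thesis .
qed

lemma nth_tau:
  assumes "i = 8 * j + l + 5" "l < 8" "j \<le> m + 5"
  shows "tau_knots m t ! i = t (int j)"
proof -
  have "tau_knots m t ! i = repeat_knots 8 t [0..int m + 5] ! (8 * j + l)"
    using assms by (simp add: tau_knots_def nth_append length_repeat_knots length_inner_knots del: length_upto)
  also have "\<dots> = t (int j)" using assms by (subst nth_repeat_knots) auto
  finally show ?thesis .
qed

text \<open>Outside a closed piece the filter at \<open>x\<close> is trivial, so only the pieces
  containing \<open>x\<close> impose a condition, and limits along several filters give the limit
  along their supremum. This glues derivatives on closed spans, knots included.\<close>

lemma has_vector_derivative_within_UN_closed:
  assumes "finite K" "\<And>k. k \<in> K \<Longrightarrow> closed (S k)"
    and "\<And>k. k \<in> K \<Longrightarrow> x \<in> S k \<Longrightarrow> (f has_vector_derivative f') (at x within S k)"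
  shows "(f has_vector_derivative f') (at x within (\<Union>k\<in>K. S k))"
  using assms
proof (induction K rule: finite_induct)
  case empty
  show ?case
    by (simp add: has_vector_derivative_def has_derivative_def bounded_linear_scaleR_left)
next
  case (insert k K)
  have "(f has_vector_derivative f') (at x within S k)"
  proof (cases "x \<in> S k")
    case True
    then show ?thesis using insert.prems by simp
  next
    case False
    then have "at x within S k = bot"
      using insert.prems(1)[of k] by (simp add: at_within_eq_bot_iff)
    then show ?thesis
      by (simp add: has_vector_derivative_def has_derivative_def bounded_linear_scaleR_left)
  qed
  moreover have "(f has_vector_derivative f') (at x within (\<Union>k\<in>K. S k))"
    using insert by simp
  ultimately show ?case
    unfolding has_vector_derivative_def has_derivative_within UN_insert
    unfolding at_within_union
    by (blast intro: filterlim_sup)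
qed

section \<open>The offset curve on a knot span\<close>

text \<open>Together with \<open>ratio_r\<close> these are the barycentric weights of a knot between
  its two neighbours, and thus the de Boor weights at that knot. The quotients of
  \<open>knot_diff\<close> by \<open>coeff_E\<close> reduce to them.\<close>

definition ratio_l :: "(int \<Rightarrow> real) \<Rightarrow> nat \<Rightarrow> real" where
  "ratio_l t k = (t (int (k + 2)) - t (int (k + 1))) / (t (int (k + 2)) - t (int k))"

definition ratio_r :: "(int \<Rightarrow> real) \<Rightarrow> nat \<Rightarrow> real" where
  "ratio_r t k = (t (int (k + 1)) - t (int k)) / (t (int (k + 2)) - t (int k))"

lemma ratio_Suc:
  "ratio_l t (k + 1) = (t (int (k + 3)) - t (int (k + 2))) / (t (int (k + 3)) - t (int (k + 1)))"
  "ratio_r t (k + 1) = (t (int (k + 2)) - t (int (k + 1))) / (t (int (k + 3)) - t (int (k + 1)))"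
proof -
  have "k + 1 + 2 = k + 3" "k + 1 + 1 = k + 2" by simp_all
  then show
    "ratio_l t (k + 1) = (t (int (k + 3)) - t (int (k + 2))) / (t (int (k + 3)) - t (int (k + 1)))"
    "ratio_r t (k + 1) = (t (int (k + 2)) - t (int (k + 1))) / (t (int (k + 3)) - t (int (k + 1)))"
    by (simp_all only: ratio_l_def ratio_r_def)
qed

lemma knot_diff_ratio:
  "knot_diff t (int k + 2) / coeff_E t k = ratio_l t k"
  "knot_diff t (int k + 1) / coeff_E t k = ratio_r t k"
proof -
  have "int (k + 2) = int k + 2" "int (k + 1) = int k + 1" "int k + 2 - 1 = int k + 1" "int k + 1 - 1 = int k"
    by simp_all
  then show "knot_diff t (int k + 2) / coeff_E t k = ratio_l t k"
    "knot_diff t (int k + 1) / coeff_E t k = ratio_r t k"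
    by (simp_all only: ratio_l_def ratio_r_def coeff_E_def knot_diff_def) simp_all
qed

lemma coeff_S_ratio: "coeff_S t \<sigma> k = ratio_l t k * \<sigma> (3*k+1) + ratio_r t k * \<sigma> (3*k+2)"
  unfolding coeff_S_def knot_diff_ratio[symmetric] by (simp add: add_divide_distrib mult.commute)

lemma coeff_P_ratio:
  "coeff_P t p k = of_real (ratio_l t k) * p (3*k+1) + of_real (ratio_r t k) * p (3*k+2)"
  unfolding coeff_P_def knot_diff_ratio[symmetric] by (simp add: add_divide_distrib mult.commute)

lemma coeff_U_ratio:
  "coeff_U t r k = of_real (ratio_l t k) * r (3*k+1) + of_real (ratio_r t k) * r (3*k+2)"
  unfolding coeff_U_def knot_diff_ratio[symmetric] by (simp add: add_divide_distrib mult.commute)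

lemma coeff_V_ratio:
  "coeff_V t r k = of_real (ratio_l t k) * r (3*k+2) + of_real (ratio_r t k) * r (3*k+3)"
  unfolding coeff_V_def knot_diff_ratio[symmetric] by (simp add: add_divide_distrib mult.commute)

text \<open>The squares in \<open>coeff_Q\<close> come from mixing twice with the same weights:
  \<open>coeff_U\<close> and \<open>coeff_V\<close> are the results of the first de Boor step at the
  knot, \<open>coeff_Q\<close> is that of the second.\<close>

lemma coeff_Q_ratio:
  "coeff_Q t r k = of_real (ratio_l t k) * coeff_U t r k + of_real (ratio_r t k) * coeff_V t r k"
  unfolding coeff_Q_def coeff_U_def coeff_V_def knot_diff_ratio[symmetric]
  by (simp add: add_divide_distrib power2_eq_square algebra_simps)

text \<open>The end points of a span of degree 9 mix the first two entries of a block. The 4/9 terms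
  share \<open>coeff_Q\<close> and their \<sigma> factors mix to \<open>coeff_S\<close>; the 5/9
  terms share \<open>coeff_S\<close>, while \<open>coeff_U\<close> and \<open>coeff_V\<close> mix to
  \<open>coeff_Q\<close>. Both give the same product, and 4/9 + 5/9 = 1.\<close>

lemma point_block_mix:
  assumes "ratio_l t k + ratio_r t k = 1"
  shows "of_real (ratio_l t k) * (point_block t \<sigma> p r h k ! 0) + of_real (ratio_r t k) * (point_block t \<sigma> p r h k ! 1)
    = coeff_Q t r k * coeff_S t \<sigma> k - \<i> * h * coeff_P t p k"
proof -
  define wl wr where "wl = complex_of_real (ratio_l t k)" and "wr = complex_of_real (ratio_r t k)"
  have "of_real (ratio_l t k + ratio_r t k) = (1 :: complex)" using assms by simp
  then have one: "wl = 1 - wr" by (simp add: wl_def wr_def algebra_simps)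
  have S: "complex_of_real (coeff_S t \<sigma> k) = wl * \<sigma> (3*k+1) + wr * \<sigma> (3*k+2)"
    by (simp add: coeff_S_ratio wl_def wr_def)
  have P: "coeff_P t p k = wl * p (3*k+1) + wr * p (3*k+2)"
    by (simp add: coeff_P_ratio wl_def wr_def)
  have Q: "coeff_Q t r k = wl * coeff_U t r k + wr * coeff_V t r k"
    by (simp add: coeff_Q_ratio wl_def wr_def)
  have "wl * (point_block t \<sigma> p r h k ! 0) + wr * (point_block t \<sigma> p r h k ! 1)
    = 4/9 * coeff_Q t r k * (wl * \<sigma> (3*k+1) + wr * \<sigma> (3*k+2))
      + 5/9 * (wl * coeff_U t r k + wr * coeff_V t r k) * coeff_S t \<sigma> k
      - \<i> * h * (4/9 * (wl * p (3*k+1) + wr * p (3*k+2)) + 5/9 * (wl + wr) * coeff_P t p k)"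
    by (simp add: point_block_def Let_def algebra_simps)
  also have "\<dots> = coeff_Q t r k * coeff_S t \<sigma> k - \<i> * h * coeff_P t p k"
    unfolding S[symmetric] P[symmetric] Q[symmetric] by (simp add: one algebra_simps)
  finally show ?thesis by (simp add: wl_def wr_def)
qed

lemma offset_point_block:
  "n = 8 * k + 11 + l \<Longrightarrow> l < 8 \<Longrightarrow> n < 8 * m + 37
    \<Longrightarrow> offset_point m t \<sigma> p r h n = point_block t \<sigma> p r h k ! l"
  by (simp add: offset_point_def)

section \<open>Bezier points of the sums over \<open>nu\<close>, \<open>rho\<close> and
  \<open>tau\<close>, and the product identity\<close>

context increasing_knots
begin

lemma ratio_sum: "k \<le> m + 4 \<Longrightarrow> ratio_l t k + ratio_r t k = 1"
  using knot_strict[of "int k" "int (k + 2)"]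
  by (simp add: ratio_l_def ratio_r_def flip: add_divide_distrib)

lemma nu_span:
  fixes p :: "nat \<Rightarrow> complex"
  assumes k: "1 \<le> k" "k \<le> m + 2" and x: "t (int (k + 1)) \<le> x" "x < t (int (k + 2))"
  shows "(\<Sum>i\<le>3*m+12. p i * of_real (bspline (nu_knots m t) 4 i x))
    = bezier 4 ((!) [coeff_P t p k, p (3*k+2), p (3*k+3), p (3*k+4), coeff_P t p (k+1)])
        ((x - t (int (k + 1))) / (t (int (k + 2)) - t (int (k + 1))))"
proof -
  \<comment> \<open>The last copy of \<open>t (int (k + 1))\<close> stands at position
    \<open>3 * k + 5\<close>; subtracting the degree 4 gives the first B-spline alive on the
    span.\<close>
  let ?ts = "nu_knots m t" and ?s = "3 * k + 1"
  let ?C = "\<lambda>i. p (?s + i)"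
  let ?u = "(x - t (int (k + 1))) / (t (int (k + 2)) - t (int (k + 1)))"
  have "(\<Sum>i\<le>3*m+12. p i * of_real (bspline ?ts 4 i x)) = (\<Sum>i\<le>4. ?C i * of_real (bspline ?ts 4 (?s + i) x))"
  proof (rule bspline_sum_local[OF sorted_nu])
    have "?ts ! (?s + 4) = t (int (k + 1))" "?ts ! (?s + 4 + 1) = t (int (k + 2))"
      by (rule nth_nu[of _ _ 2]; use k in simp) (rule nth_nu[of _ _ 0]; use k in simp)
    then show "?ts ! (?s + 4) \<le> x" "x < ?ts ! (?s + 4 + 1)" using x by simp_all
  qed (use k in \<open>simp_all add: length_nu\<close>)
  also have "\<dots> = (\<Sum>i\<le>Suc 3. ?C i * of_real (bspline ?ts (Suc 3) (?s + i) x))" by (simp only: Suc_numeral add_num_simps)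
  also have "\<dots> = bezier (Suc 3) (\<lambda>i. if i = 0 then of_real (ratio_l t k) * ?C 0 + of_real (ratio_r t k) * ?C 1
        else if i = Suc 3 then of_real (ratio_l t (k + 1)) * ?C 3 + of_real (ratio_r t (k + 1)) * ?C (Suc 3)
        else ?C i) ?u"
    unfolding ratio_Suc unfolding ratio_l_def ratio_r_def
  proof (rule bspline_sum_bezier[OF sorted_nu _ _ _ _ _ _ x])
    show "?ts ! (?s + 1) = t (int k)" by (rule nth_nu[of _ _ 2]; use k in simp)
    show "?ts ! (?s + 2 + i) = t (int (k + 1))" "?ts ! (?s + 3 + 2 + i) = t (int (k + 2))" if "i < 3" for i
      by (rule nth_nu[of _ _ i]; use k that in simp)+
    show "?ts ! (?s + 2 * 3 + 2) = t (int (k + 3))" by (rule nth_nu[of _ _ 0]; use k in simp)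
  qed (use k in \<open>simp_all add: length_nu\<close>)
  also have "\<dots> = bezier 4 ((!) [coeff_P t p k, p (3*k+2), p (3*k+3), p (3*k+4), coeff_P t p (k+1)]) ?u"
    unfolding Suc_numeral add_num_simps
  proof (rule bezier_cong)
    fix i :: nat assume "i \<le> 4"
    then consider "i = 0" | "i = 1" | "i = 2" | "i = 3" | "i = 4" by linarith
    then show "(if i = 0 then of_real (ratio_l t k) * ?C 0 + of_real (ratio_r t k) * ?C 1
        else if i = 4 then of_real (ratio_l t (k + 1)) * ?C 3 + of_real (ratio_r t (k + 1)) * ?C 4
        else ?C i) = [coeff_P t p k, p (3*k+2), p (3*k+3), p (3*k+4), coeff_P t p (k+1)] ! i"
      by cases (simp_all add: coeff_P_ratio numeral_eq_Suc)
  qed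
  finally show ?thesis .
qed

lemma rho_span:
  fixes r :: "nat \<Rightarrow> complex"
  assumes k: "1 \<le> k" "k \<le> m + 2" and x: "t (int (k + 1)) \<le> x" "x < t (int (k + 2))"
  shows "(\<Sum>i\<le>3*m+13. r i * of_real (bspline (rho_knots m t) 5 i x))
    = bezier 5 ((!) [coeff_Q t r k, coeff_V t r k, r (3*k+3), r (3*k+4), coeff_U t r (k+1), coeff_Q t r (k+1)])
        ((x - t (int (k + 1))) / (t (int (k + 2)) - t (int (k + 1))))"
proof -
  let ?ts = "rho_knots m t" and ?s = "3 * k + 1"
  let ?C = "\<lambda>i. r (?s + i)"
  let ?u = "(x - t (int (k + 1))) / (t (int (k + 2)) - t (int (k + 1)))"
  have kn: "?ts ! (?s + 1) = t (int k)" "?ts ! (?s + 2) = t (int k)"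
    "?ts ! (?s + 3) = t (int (k + 1))" "?ts ! (?s + 4) = t (int (k + 1))" "?ts ! (?s + 5) = t (int (k + 1))"
    "?ts ! (?s + 6) = t (int (k + 2))" "?ts ! (?s + 7) = t (int (k + 2))" "?ts ! (?s + 8) = t (int (k + 2))"
    "?ts ! (?s + 9) = t (int (k + 3))" "?ts ! (?s + 10) = t (int (k + 3))"
    by (rule nth_rho[of _ _ 1] nth_rho[of _ _ 2] nth_rho[of _ _ 0]; use k in \<open>simp; fail\<close>)+
  have len: "?s + 11 < 3 * m + 20" using k by simp
  have "(\<Sum>i\<le>3*m+13. r i * of_real (bspline ?ts 5 i x)) = (\<Sum>i\<le>5. ?C i * of_real (bspline ?ts 5 (?s + i) x))"
  proof (rule bspline_sum_local[OF sorted_rho])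
    show "?ts ! (?s + 5) \<le> x" using kn x by simp
    have "?s + 5 + 1 = ?s + 6" by simp
    then show "x < ?ts ! (?s + 5 + 1)" using kn x by metis
  qed (use k in \<open>simp_all add: length_rho\<close>)
  also have "\<dots> = bezier 5 ((!) [coeff_Q t r k, coeff_V t r k, r (3*k+3), r (3*k+4), coeff_U t r (k+1), coeff_Q t r (k+1)]) ?u"
    unfolding bspline_quintic_sum_bezier[OF sorted_rho _ kn x refl refl refl refl, unfolded length_rho, OF len]
      ratio_l_def[symmetric] ratio_r_def[symmetric] ratio_Suc[symmetric]
  proof -
    have idx: "?s + 0 = 3 * k + 1" "?s + 1 = 3 * k + 2" "?s + 2 = 3 * k + 3" "?s + 3 = 3 * k + 4"
      "?s + 4 = 3 * k + 5" "?s + 5 = 3 * k + 6"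
      "3 * (k + 1) + 1 = 3 * k + 4" "3 * (k + 1) + 2 = 3 * k + 5" "3 * (k + 1) + 3 = 3 * k + 6"
      by simp_all
    show "bezier 5 ((!) [of_real (ratio_l t k) * (of_real (ratio_l t k) * ?C 0 + of_real (ratio_r t k) * ?C 1)
          + of_real (ratio_r t k) * (of_real (ratio_l t k) * ?C 1 + of_real (ratio_r t k) * ?C 2),
        of_real (ratio_l t k) * ?C 1 + of_real (ratio_r t k) * ?C 2, ?C 2, ?C 3,
        of_real (ratio_l t (k+1)) * ?C 3 + of_real (ratio_r t (k+1)) * ?C 4,
        of_real (ratio_l t (k+1)) * (of_real (ratio_l t (k+1)) * ?C 3 + of_real (ratio_r t (k+1)) * ?C 4)
          + of_real (ratio_r t (k+1)) * (of_real (ratio_l t (k+1)) * ?C 4 + of_real (ratio_r t (k+1)) * ?C 5)]) ?u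
      = bezier 5 ((!) [coeff_Q t r k, coeff_V t r k, r (3*k+3), r (3*k+4), coeff_U t r (k+1), coeff_Q t r (k+1)]) ?u"
      by (simp only: coeff_Q_ratio coeff_U_ratio coeff_V_ratio idx)
  qed
  finally show ?thesis .
qed

lemma tau_span:
  fixes q :: "nat \<Rightarrow> complex"
  assumes k: "1 \<le> k" "k \<le> m + 2" and x: "t (int (k + 1)) \<le> x" "x < t (int (k + 2))"
  shows "(\<Sum>i\<le>8*m+47. q i * of_real (bspline (tau_knots m t) 9 i x))
    = bezier 9 (\<lambda>i. if i = 0 then of_real (ratio_l t k) * q (8*k+11+0) + of_real (ratio_r t k) * q (8*k+11+1)
        else if i = 9 then of_real (ratio_l t (k + 1)) * q (8*k+11+8) + of_real (ratio_r t (k + 1)) * q (8*k+11+9)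
        else q (8*k+11+i)) ((x - t (int (k + 1))) / (t (int (k + 2)) - t (int (k + 1))))"
proof -
  \<comment> \<open>The last copy of \<open>t (int (k + 1))\<close> is at position
    \<open>8 * k + 20\<close>, and the degree is 9. The ten B-splines alive on the span therefore
    belong to block \<open>k\<close> and the first two entries of block
    \<open>k + 1\<close>.\<close>
  let ?ts = "tau_knots m t" and ?s = "8 * k + 11"
  let ?u = "(x - t (int (k + 1))) / (t (int (k + 2)) - t (int (k + 1)))"
  have "(\<Sum>i\<le>8*m+47. q i * of_real (bspline ?ts 9 i x)) = (\<Sum>i\<le>9. q (?s + i) * of_real (bspline ?ts 9 (?s + i) x))"
  proof (rule bspline_sum_local[OF sorted_tau])
    have "?ts ! (?s + 9) = t (int (k + 1))" "?ts ! (?s + 9 + 1) = t (int (k + 2))"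
      by (rule nth_tau[of _ _ 7]; use k in simp) (rule nth_tau[of _ _ 0]; use k in simp)
    then show "?ts ! (?s + 9) \<le> x" "x < ?ts ! (?s + 9 + 1)" using x by simp_all
  qed (use k in \<open>simp_all add: length_tau\<close>)
  also have "\<dots> = (\<Sum>i\<le>Suc 8. q (?s + i) * of_real (bspline ?ts (Suc 8) (?s + i) x))"
    by (simp only: Suc_numeral add_num_simps)
  also have "\<dots> = bezier (Suc 8) (\<lambda>i. if i = 0 then of_real (ratio_l t k) * q (?s + 0) + of_real (ratio_r t k) * q (?s + 1)
        else if i = Suc 8 then of_real (ratio_l t (k + 1)) * q (?s + 8) + of_real (ratio_r t (k + 1)) * q (?s + Suc 8)
        else q (?s + i)) ?u"
    unfolding ratio_Suc unfolding ratio_l_def ratio_r_def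
  proof (rule bspline_sum_bezier[OF sorted_tau _ _ _ _ _ _ x])
    show "?ts ! (?s + 1) = t (int k)" by (rule nth_tau[of _ _ 7]; use k in simp)
    show "?ts ! (?s + 2 + i) = t (int (k + 1))" "?ts ! (?s + 8 + 2 + i) = t (int (k + 2))" if "i < 8" for i
      by (rule nth_tau[of _ _ i]; use k that in simp)+
    show "?ts ! (?s + 2 * 8 + 2) = t (int (k + 3))" by (rule nth_tau[of _ _ 0]; use k in simp)
  qed (use k in \<open>simp_all add: length_tau\<close>)
  finally show ?thesis by (simp only: Suc_numeral add_num_simps)
qed

text \<open>Stated for arbitrary coefficient sequences, so that the weights become a special case.
  Both sides are forms of degree 9 on the span and agree point by point; the two end points need
  \<open>point_block_mix\<close>.\<close>

lemma offset_point_sum: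
  assumes k: "1 \<le> k" "k \<le> m + 2" and x: "t (int (k + 1)) \<le> x" "x < t (int (k + 2))"
  shows "(\<Sum>i\<le>8*m+47. offset_point m t \<sigma> p r h i * of_real (bspline (tau_knots m t) 9 i x))
    = (\<Sum>i\<le>3*m+13. r i * of_real (bspline (rho_knots m t) 5 i x))
        * (\<Sum>i\<le>3*m+12. of_real (\<sigma> i) * of_real (bspline (nu_knots m t) 4 i x))
      - \<i> * h * (\<Sum>i\<le>3*m+12. p i * of_real (bspline (nu_knots m t) 4 i x))"
proof -
  let ?u = "(x - t (int (k + 1))) / (t (int (k + 2)) - t (int (k + 1)))"
  let ?\<sigma> = "\<lambda>i. complex_of_real (\<sigma> i)"
  let ?B = "point_block t \<sigma> p r h k" and ?B' = "point_block t \<sigma> p r h (k + 1)"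
  let ?q = "\<lambda>i. if i < 8 then ?B ! i else ?B' ! (i - 8)"
  define R where "R = [coeff_Q t r k, coeff_V t r k, r (3*k+3), r (3*k+4), coeff_U t r (k+1), coeff_Q t r (k+1)]"
  define S where "S = [coeff_P t ?\<sigma> k, ?\<sigma> (3*k+2), ?\<sigma> (3*k+3), ?\<sigma> (3*k+4), coeff_P t ?\<sigma> (k+1)]"
  define P where "P = [coeff_P t p k, p (3*k+2), p (3*k+3), p (3*k+4), coeff_P t p (k+1)]"
  \<comment> \<open>\<open>nu_span\<close> concerns complex coefficients; applied to the embedded
    \<sigma> it produces \<open>coeff_P\<close> in place of \<open>coeff_S\<close>.\<close>
  have S: "coeff_P t ?\<sigma> l = coeff_S t \<sigma> l" for l
    by (simp add: coeff_P_ratio coeff_S_ratio)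
  have blk: "offset_point m t \<sigma> p r h (8*k+11+i) = ?q i" if "i \<le> 9" for i
  proof (cases "i < 8")
    case True
    then have "offset_point m t \<sigma> p r h (8*k+11+i) = ?B ! i"
      using k by (intro offset_point_block[OF refl]) auto
    then show ?thesis using True by simp
  next
    case False
    then have "offset_point m t \<sigma> p r h (8*k+11+i) = ?B' ! (i - 8)"
      using k that by (intro offset_point_block) auto
    then show ?thesis using False by simp
  qed
  have "(\<Sum>i\<le>8*m+47. offset_point m t \<sigma> p r h i * of_real (bspline (tau_knots m t) 9 i x))
    = bezier 9 (\<lambda>i. if i = 0 then of_real (ratio_l t k) * ?B ! 0 + of_real (ratio_r t k) * ?B ! 1
        else if i = 9 then of_real (ratio_l t (k + 1)) * ?B' ! 0 + of_real (ratio_r t (k + 1)) * ?B' ! 1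
        else ?q i) ?u"
    unfolding tau_span[OF k x]
  proof (rule bezier_cong)
    fix i :: nat assume i: "i \<le> 9"
    have B: "offset_point m t \<sigma> p r h (8*k+11+0) = ?B ! 0" "offset_point m t \<sigma> p r h (8*k+11+1) = ?B ! 1"
      "offset_point m t \<sigma> p r h (8*k+11+8) = ?B' ! 0" "offset_point m t \<sigma> p r h (8*k+11+9) = ?B' ! 1"
      using blk[of 0] blk[of 1] blk[of 8] blk[of 9] by simp_all
    show "(if i = 0 then of_real (ratio_l t k) * offset_point m t \<sigma> p r h (8*k+11+0)
             + of_real (ratio_r t k) * offset_point m t \<sigma> p r h (8*k+11+1)
        else if i = 9 then of_real (ratio_l t (k + 1)) * offset_point m t \<sigma> p r h (8*k+11+8)
             + of_real (ratio_r t (k + 1)) * offset_point m t \<sigma> p r h (8*k+11+9)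
        else offset_point m t \<sigma> p r h (8*k+11+i))
      = (if i = 0 then of_real (ratio_l t k) * ?B ! 0 + of_real (ratio_r t k) * ?B ! 1
        else if i = 9 then of_real (ratio_l t (k + 1)) * ?B' ! 0 + of_real (ratio_r t (k + 1)) * ?B' ! 1
        else ?q i)"
      unfolding B blk[OF i] by (rule refl)
  qed
  also have "\<dots> = bezier 5 ((!) R) ?u * bezier 4 ((!) S) ?u
      - \<i> * h * (bezier 5 (\<lambda>_. 1) ?u * bezier 4 ((!) P) ?u)"
  proof -
    have sum1: "ratio_l t k + ratio_r t k = 1" "ratio_l t (k + 1) + ratio_r t (k + 1) = 1"
      using k by (auto intro!: ratio_sum)
    have *: "X - \<i> * h * Y = 1 * X + (- \<i> * h) * Y" for X Y :: complex by simp
    show ?thesis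
      unfolding bezier_mult_5_4 * bezier_linear[symmetric]
    proof (rule bezier_cong, goal_cases)
      case (1 i)
      then have "i \<in> {..9}" by simp
      moreover have "{..9::nat} = {0,1,2,3,4,5,6,7,8,9}" by auto
      ultimately have "i \<in> {0,1,2,3,4,5,6,7,8,9}" by simp
      then show ?case
        unfolding point_block_mix[OF sum1(1)] point_block_mix[OF sum1(2)]
        by (elim insertE emptyE)
          (simp_all add: R_def S_def P_def S point_block_def Let_def algebra_simps)
    qed
  qed
  finally show ?thesis
    unfolding nu_span[OF k x] rho_span[OF k x] bezier_const by (simp add: R_def S_def P_def)
qed

text \<open>The weights are the control points for the constant curve 1, that is, for \<open>r = 1\<close>, \<open>p = 0\<close>, \<open>h = 0\<close>.\<close>

lemma offset_weight_sum:
  assumes k: "1 \<le> k" "k \<le> m + 2" and x: "t (int (k + 1)) \<le> x" "x < t (int (k + 2))"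
  shows "(\<Sum>i\<le>8*m+47. offset_weight m t \<sigma> i * bspline (tau_knots m t) 9 i x)
    = (\<Sum>i\<le>3*m+12. \<sigma> i * bspline (nu_knots m t) 4 i x)"
proof -
  have one: "complex_of_real (ratio_l t l) + of_real (ratio_r t l) = 1" if "l \<le> m + 4" for l
    using ratio_sum[OF that] by (metis of_real_1 of_real_add)
  then have UVQ: "coeff_U t (\<lambda>_. 1) l = 1" "coeff_V t (\<lambda>_. 1) l = 1" "coeff_Q t (\<lambda>_. 1) l = 1" if "l \<le> m + 4" for l
    using that by (simp_all add: coeff_U_ratio coeff_V_ratio coeff_Q_ratio)
  have block: "of_real (weight_block t \<sigma> l ! j) = point_block t \<sigma> (\<lambda>_. 0) (\<lambda>_. 1) 0 l ! j" if "l \<le> m + 3" "j < 8" for l j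
  proof -
    have "j \<in> {..<8}" using that by simp
    moreover have "{..<8::nat} = {0,1,2,3,4,5,6,7}" by auto
    ultimately have "j \<in> {0,1,2,3,4,5,6,7}" by simp
    then show ?thesis
      using UVQ[of l] UVQ[of "l + 1"] that
      by (elim insertE emptyE) (simp_all add: weight_block_def point_block_def Let_def coeff_P_ratio)
  qed
  have weight: "of_real (offset_weight m t \<sigma> i) = offset_point m t \<sigma> (\<lambda>_. 0) (\<lambda>_. 1) 0 i" for i
  proof -
    have "(i - 11) div 8 \<le> m + 3" if "\<not> 8*m+37 \<le> i" using that by simp
    then show ?thesis
      using block[of "(i - 11) div 8" "(i - 11) mod 8"] by (auto simp: offset_weight_def offset_point_def)
  qed
  \<comment> \<open>Partition of unity on the span: with all coefficients 1, all six Bezier points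
    are 1.\<close>
  have ones: "(\<Sum>i\<le>3*m+13. 1 * complex_of_real (bspline (rho_knots m t) 5 i x)) = 1"
  proof -
    have "(!) [1, 1, 1, 1, 1, 1 :: complex] i = 1" if "i \<le> 5" for i
      using that by (simp add: nth_Cons' split: if_splits)
    then show ?thesis
      unfolding rho_span[OF k x] using UVQ[of k] UVQ[of "k + 1"] k
      by (simp add: bezier_const cong: bezier_cong)
  qed
  have "complex_of_real (\<Sum>i\<le>8*m+47. offset_weight m t \<sigma> i * bspline (tau_knots m t) 9 i x)
    = of_real (\<Sum>i\<le>3*m+12. \<sigma> i * bspline (nu_knots m t) 4 i x)"
    using offset_point_sum[OF k x, of \<sigma> "\<lambda>_. 0" "\<lambda>_. 1" 0] unfolding ones by (simp add: weight)
  then show ?thesis by (simp only: of_real_eq_iff)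
qed

section \<open>Derivative of the curve within the closed interval\<close>

lemma span_ends:
  assumes "1 \<le> k" "k \<le> m + 2"
  shows "t (int (k + 1)) < t (int (k + 2))"
  using assms by (intro knot_strict) auto

text \<open>At the right end the half-open B-splines already belong to the next span, at parameter
  0. The value is the same because adjacent spans share the end point
  \<open>coeff_Q t r (k+1)\<close> or \<open>coeff_P t p (k+1)\<close>. The next span has to be
  admissible too, hence the bound \<open>m + 1\<close>.\<close>

lemma ph_curve_closed_span:
  assumes k: "1 \<le> k" "k \<le> m + 1" and x: "t (int (k + 1)) \<le> x" "x \<le> t (int (k + 2))"
  shows "ph_curve m t r x
      = bezier 5 ((!) [coeff_Q t r k, coeff_V t r k, r (3*k+3), r (3*k+4), coeff_U t r (k+1), coeff_Q t r (k+1)])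
          ((x - t (int (k + 1))) / (t (int (k + 2)) - t (int (k + 1))))"
    and "(\<Sum>i\<le>3*m+12. p i * of_real (bspline (nu_knots m t) 4 i x))
      = bezier 4 ((!) [coeff_P t p k, p (3*k+2), p (3*k+3), p (3*k+4), coeff_P t p (k+1)])
          ((x - t (int (k + 1))) / (t (int (k + 2)) - t (int (k + 1))))"
proof -
  have k2: "k \<le> m + 2" "1 \<le> k + 1" "k + 1 \<le> m + 2" using k by simp_all
  have next_ends: "t (int (k + 1 + 1)) \<le> x" "x < t (int (k + 1 + 2))" if "x = t (int (k + 2))"
    using that span_ends[OF k2(2,3)] by simp_all
  have u: "(x - t (int (k + 1))) / (t (int (k + 2)) - t (int (k + 1))) = 1"
      "(x - t (int (k + 1 + 1))) / (t (int (k + 1 + 2)) - t (int (k + 1 + 1))) = 0" if "x = t (int (k + 2))"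
    using that span_ends[OF k(1) k2(1)] by simp_all
  show "ph_curve m t r x
      = bezier 5 ((!) [coeff_Q t r k, coeff_V t r k, r (3*k+3), r (3*k+4), coeff_U t r (k+1), coeff_Q t r (k+1)])
          ((x - t (int (k + 1))) / (t (int (k + 2)) - t (int (k + 1))))"
  proof (cases "x = t (int (k + 2))")
    case True
    show ?thesis
      unfolding ph_curve_def rho_span[OF k2(2,3) next_ends[OF True]] u[OF True] bezier_0 bezier_1 by simp
  qed (use rho_span[OF k(1) k2(1), of x r] x in \<open>simp add: ph_curve_def\<close>)
  show "(\<Sum>i\<le>3*m+12. p i * of_real (bspline (nu_knots m t) 4 i x))
      = bezier 4 ((!) [coeff_P t p k, p (3*k+2), p (3*k+3), p (3*k+4), coeff_P t p (k+1)])
          ((x - t (int (k + 1))) / (t (int (k + 2)) - t (int (k + 1))))"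
  proof (cases "x = t (int (k + 2))")
    case True
    show ?thesis
      unfolding nu_span[OF k2(2,3) next_ends[OF True]] u[OF True] bezier_0 bezier_1 by simp
  qed (use nu_span[OF k(1) k2(1), of x p] x in simp)
qed

text \<open>The differences of the quintic points must be \<open>D / 5\<close> times the quartic
  points, \<open>D\<close> being the length of the span. In the recursion for \<open>r\<close> the
  knot differences are successively \<open>E\<close>, \<open>E\<close>, \<open>D\<close>,
  \<open>E'\<close>, \<open>E'\<close>; the mixing ratios turn \<open>E\<close> and
  \<open>E'\<close> into \<open>D\<close>.\<close>

lemma ph_curve_derivative_closed_span:
  fixes p r :: "nat \<Rightarrow> complex"
  assumes r: "\<And>i. i \<le> 3*m+12 \<Longrightarrow> r (i+1) = r i + (nu_knots m t ! (i+5) - nu_knots m t ! i) / 5 * p i"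
    and k: "1 \<le> k" "k \<le> m + 1" and x: "x \<in> {t (int (k + 1))..t (int (k + 2))}"
  shows "(ph_curve m t r has_vector_derivative (\<Sum>i\<le>3*m+12. p i * of_real (bspline (nu_knots m t) 4 i x)))
    (at x within {t (int (k + 1))..t (int (k + 2))})"
proof -
  let ?b = "t (int (k + 1))" and ?c = "t (int (k + 2))"
  let ?u = "\<lambda>x. (x - ?b) / (?c - ?b)"
  let ?R = "[coeff_Q t r k, coeff_V t r k, r (3*k+3), r (3*k+4), coeff_U t r (k+1), coeff_Q t r (k+1)]"
  let ?P = "[coeff_P t p k, p (3*k+2), p (3*k+3), p (3*k+4), coeff_P t p (k+1)]"
  have bc: "?b < ?c" using k by (intro span_ends) auto
  have ac: "t (int k) < ?c" and be: "?b < t (int (k + 3))" using k by (intro knot_strict; simp)+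
  define D E E' where "D = complex_of_real (?c - ?b)" and "E = complex_of_real (?c - t (int k))"
    and "E' = complex_of_real (t (int (k + 3)) - ?b)"
  have D0: "D \<noteq> 0" using bc by (simp add: D_def)
  have wE: "of_real (ratio_l t k) * E = D" "of_real (ratio_r t (k + 1)) * E' = D"
    unfolding ratio_Suc(2) unfolding ratio_l_def D_def E_def E'_def of_real_mult[symmetric] using ac be by simp_all
  have kn: "nu_knots m t ! (3*k+1) = t (int k)" "nu_knots m t ! (3*k+2) = t (int k)"
    "nu_knots m t ! (3*k+3) = ?b" "nu_knots m t ! (3*k+4) = ?b" "nu_knots m t ! (3*k+5) = ?b"
    "nu_knots m t ! (3*k+6) = ?c" "nu_knots m t ! (3*k+7) = ?c" "nu_knots m t ! (3*k+8) = ?c"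
    "nu_knots m t ! (3*k+9) = t (int (k + 3))" "nu_knots m t ! (3*k+10) = t (int (k + 3))"
    by (rule nth_nu[of _ _ 1] nth_nu[of _ _ 2] nth_nu[of _ _ 0]; use k in \<open>simp; fail\<close>)+
  have step: "r (3*k+i+1) = r (3*k+i) + of_real (nu_knots m t ! (3*k+(i+5)) - nu_knots m t ! (3*k+i)) / 5 * p (3*k+i)"
    if "i \<le> 5" for i
    using r[of "3*k+i"] that k by (simp add: add.assoc)
  have rs: "r (3*k+2) = r (3*k+1) + E / 5 * p (3*k+1)" "r (3*k+3) = r (3*k+2) + E / 5 * p (3*k+2)"
    "r (3*k+4) = r (3*k+3) + D / 5 * p (3*k+3)"
    "r (3*k+5) = r (3*k+4) + E' / 5 * p (3*k+4)" "r (3*k+6) = r (3*k+5) + E' / 5 * p (3*k+5)"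
    using step[of 1] step[of 2] step[of 3] step[of 4] step[of 5]
    by (simp_all only: add.assoc add_num_simps numeral_plus_numeral numeral_plus_one one_plus_numeral one_add_one
        kn D_def E_def E'_def)
  have idx: "3 * (k + 1) + 1 = 3 * k + 4" "3 * (k + 1) + 2 = 3 * k + 5" "3 * (k + 1) + 3 = 3 * k + 6"
    by simp_all
  \<comment> \<open>At each end one ratio is eliminated; the one that remains is the one that
    \<open>wE\<close> converts.\<close>
  have one: "complex_of_real (ratio_r t k) = 1 - of_real (ratio_l t k)"
      "complex_of_real (ratio_l t (k + 1)) = 1 - of_real (ratio_r t (k + 1))"
  proof -
    have "ratio_r t k = 1 - ratio_l t k" "ratio_l t (k + 1) = 1 - ratio_r t (k + 1)"
      using ratio_sum[of k] ratio_sum[of "k + 1"] k by simp_all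
    then show "complex_of_real (ratio_r t k) = 1 - of_real (ratio_l t k)"
      "complex_of_real (ratio_l t (k + 1)) = 1 - of_real (ratio_r t (k + 1))"
      by (simp_all only: of_real_diff of_real_1)
  qed
  have VU: "coeff_V t r k - coeff_U t r k = E / 5 * coeff_P t p k"
      "coeff_V t r (k + 1) - coeff_U t r (k + 1) = E' / 5 * coeff_P t p (k + 1)"
    by (simp_all only: coeff_V_ratio coeff_U_ratio coeff_P_ratio idx rs(1,2,4,5)) (simp_all add: algebra_simps)
  have "coeff_V t r k - coeff_Q t r k = of_real (ratio_l t k) * (coeff_V t r k - coeff_U t r k)"
    by (simp only: coeff_Q_ratio one) (simp add: algebra_simps)
  also have "\<dots> = (of_real (ratio_l t k) * E) / 5 * coeff_P t p k" unfolding VU by simp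
  finally have d0: "coeff_V t r k - coeff_Q t r k = D / 5 * coeff_P t p k" unfolding wE .
  have "r (3*k+3) - coeff_V t r k = of_real (ratio_l t k) * (r (3*k+3) - r (3*k+2))"
    by (simp only: coeff_V_ratio one) (simp add: algebra_simps)
  also have "\<dots> = (of_real (ratio_l t k) * E) / 5 * p (3*k+2)" unfolding rs(2) by simp
  finally have d1: "r (3*k+3) - coeff_V t r k = D / 5 * p (3*k+2)" unfolding wE .
  have d2: "r (3*k+4) - r (3*k+3) = D / 5 * p (3*k+3)" unfolding rs(3) by simp
  have "coeff_U t r (k+1) - r (3*k+4) = of_real (ratio_r t (k+1)) * (r (3*k+5) - r (3*k+4))"
    by (simp only: coeff_U_ratio one idx) (simp add: algebra_simps)
  also have "\<dots> = (of_real (ratio_r t (k+1)) * E') / 5 * p (3*k+4)" unfolding rs(4) by simp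
  finally have d3: "coeff_U t r (k+1) - r (3*k+4) = D / 5 * p (3*k+4)" unfolding wE .
  have "coeff_Q t r (k+1) - coeff_U t r (k+1) = of_real (ratio_r t (k+1)) * (coeff_V t r (k+1) - coeff_U t r (k+1))"
    by (simp only: coeff_Q_ratio one) (simp add: algebra_simps)
  also have "\<dots> = (of_real (ratio_r t (k+1)) * E') / 5 * coeff_P t p (k+1)" unfolding VU by simp
  finally have d4: "coeff_Q t r (k+1) - coeff_U t r (k+1) = D / 5 * coeff_P t p (k+1)" unfolding wE .
  have diffs: "?R ! Suc i - ?R ! i = D / 5 * ?P ! i" if "i \<le> 4" for i
  proof -
    consider "i = 0" | "i = 1" | "i = 2" | "i = 3" | "i = 4" using \<open>i \<le> 4\<close> by linarith
    then show ?thesis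
      by cases (use d0 d1 d2 d3 d4 in \<open>simp_all add: numeral_eq_Suc\<close>)
  qed
  have "((bezier (Suc 4) ((!) ?R) \<circ> ?u) has_vector_derivative
      (1 / (?c - ?b)) *\<^sub>R (of_nat (Suc 4) * bezier 4 (\<lambda>i. ?R ! Suc i - ?R ! i) (?u x)))
      (at x within {?b..?c})"
    using bc by (intro vector_diff_chain_within bezier_has_vector_derivative) (auto intro!: derivative_eq_intros)
  moreover have "(1 / (?c - ?b)) *\<^sub>R (of_nat (Suc 4) * bezier 4 (\<lambda>i. ?R ! Suc i - ?R ! i) (?u x))
      = bezier 4 ((!) ?P) (?u x)"
  proof -
    \<comment> \<open>The zero summand supplies the two-term shape required by
      \<open>bezier_linear\<close>.\<close>
    have "bezier 4 (\<lambda>i. ?R ! Suc i - ?R ! i) (?u x) = bezier 4 (\<lambda>i. D / 5 * ?P ! i + 0 * ?P ! i) (?u x)"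
      by (rule bezier_cong) (simp only: diffs mult_zero_left add_0_right)
    also have "\<dots> = D / 5 * bezier 4 ((!) ?P) (?u x)" by (simp only: bezier_linear) simp
    finally show ?thesis using D0 by (simp only:) (simp add: scaleR_conv_of_real D_def)
  qed
  ultimately have "((bezier 5 ((!) ?R) \<circ> ?u) has_vector_derivative
      (\<Sum>i\<le>3*m+12. p i * of_real (bspline (nu_knots m t) 4 i x))) (at x within {?b..?c})"
    using ph_curve_closed_span(2)[OF k, of x p] x by (simp only: Suc_numeral add_num_simps atLeastAtMost_iff)
  then show ?thesis
    by (rule has_vector_derivative_transform[OF x, rotated]) (simp add: ph_curve_closed_span(1)[OF k])
qed

lemma span_cover:
  "t 2 \<le> x \<Longrightarrow> x < t (int (n + 2)) \<Longrightarrow> \<exists>k. 1 \<le> k \<and> k \<le> n \<and> t (int (k + 1)) \<le> x \<and> x < t (int (k + 2))"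
proof (induction n)
  case (Suc n)
  show ?case
  proof (cases "x < t (int (n + 2))")
    case True
    then show ?thesis using Suc by (meson le_SucI)
  next
    case False
    have "Suc n + 1 = n + 2" by simp
    then show ?thesis using Suc.prems False by (intro exI[of _ "Suc n"]) (simp del: of_nat_add of_nat_Suc)
  qed
qed simp

text \<open>At a common knot both adjacent closed spans give the same sum as derivative, so gluing
  covers the whole interval, with one-sided derivatives at its ends.\<close>

lemma ph_curve_derivative:
  fixes p r :: "nat \<Rightarrow> complex"
  assumes r: "\<And>i. i \<le> 3*m+12 \<Longrightarrow> r (i+1) = r i + (nu_knots m t ! (i+5) - nu_knots m t ! i) / 5 * p i"
    and x: "x \<in> {t 2..t (int m + 3)}"
  shows "vector_derivative (ph_curve m t r) (at x within {t 2..t (int m + 3)})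
    = (\<Sum>i\<le>3*m+12. p i * of_real (bspline (nu_knots m t) 4 i x))"
proof (rule vector_derivative_within_closed_interval)
  let ?S = "\<lambda>k. {t (int (k + 1))..t (int (k + 2))}"
  show "t 2 < t (int m + 3)" by (rule knot_strict) auto
  have "{t 2..t (int m + 3)} \<subseteq> (\<Union>k\<in>{1..m+1}. ?S k)"
  proof
    fix y assume y: "y \<in> {t 2..t (int m + 3)}"
    show "y \<in> (\<Union>k\<in>{1..m+1}. ?S k)"
    proof (cases "y = t (int m + 3)")
      case True
      have last: "int (m + 1 + 2) = int m + 3" by simp
      have "y \<in> ?S (m + 1)" using span_ends[of "m + 1"] unfolding True last by simp
      then show ?thesis by force
    next
      case False
      have last: "int (m + 1 + 2) = int m + 3" by simp
      have "y < t (int (m + 1 + 2))" using y False unfolding last by simp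
      then obtain k where "1 \<le> k" "k \<le> m + 1" "t (int (k + 1)) \<le> y" "y < t (int (k + 2))"
        using span_cover[of y "m + 1"] y by auto
      then show ?thesis by (intro UN_I[of k]) auto
    qed
  qed
  moreover have "(ph_curve m t r has_vector_derivative (\<Sum>i\<le>3*m+12. p i * of_real (bspline (nu_knots m t) 4 i x)))
      (at x within (\<Union>k\<in>{1..m+1}. ?S k))"
    by (rule has_vector_derivative_within_UN_closed) (use ph_curve_derivative_closed_span[OF r] in auto)
  ultimately show "(ph_curve m t r has_vector_derivative (\<Sum>i\<le>3*m+12. p i * of_real (bspline (nu_knots m t) 4 i x)))
      (at x within {t 2..t (int m + 3)})"
    by (rule has_vector_derivative_within_subset[rotated])
qed (use x in auto)

end

theorem mainTheorem14:
  fixes m :: nat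
    and t :: "int \<Rightarrow> real"
    and z p r :: "nat \<Rightarrow> complex"
    and \<sigma> :: "nat \<Rightarrow> real"
  assumes "m \<ge> 2"
    and "t 0 = 0"
    and "\<And>k. k \<in> {-1..int m + 5} \<Longrightarrow> t k < t (k + 1)"
    and "knot_diff t (int m + 3) = knot_diff t 2"
    and "knot_diff t (int m + 4) = knot_diff t 3"
    and "\<And>x. x \<in> {t 0..t (int m + 5)} \<Longrightarrow>
           (preimage_curve m t z x)\<^sup>2 = (\<Sum>k\<le>3*m+12. p k * bspline (nu_knots m t) 4 k x)"
    and "\<And>x. x \<in> {t 0..t (int m + 5)} \<Longrightarrow>
           preimage_curve m t z x * cnj (preimage_curve m t z x)
             = (\<Sum>k\<le>3*m+12. \<sigma> k * bspline (nu_knots m t) 4 k x)"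
    and "\<And>k. k \<in> {0, 1, 2} \<Longrightarrow>
           (\<Sum>j=6-k..3*m+8-k. (nu_knots m t ! (j+5) - nu_knots m t ! j) * p j) = 0"
    and "\<And>i. i \<le> 3*m+12 \<Longrightarrow>
           r (i+1) = r i + (nu_knots m t ! (i+5) - nu_knots m t ! i) / 5 * p i"
    and "\<And>x. x \<in> {t 2..t (int m + 3)} \<Longrightarrow> preimage_curve m t z x \<noteq> 0"
  shows "\<forall>h::real. \<forall>x\<in>{t 2..t (int m + 3)}.
           offset_curve {t 2..t (int m + 3)} (ph_curve m t r) h x
             = (\<Sum>k\<le>8*m+47. offset_point m t \<sigma> p r h k * bspline (tau_knots m t) 9 k x)
               / (\<Sum>k\<le>8*m+47. offset_weight m t \<sigma> k * bspline (tau_knots m t) 9 k x)"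
proof (intro allI ballI)
  interpret increasing_knots m t by standard (fact assms(3))
  fix h x :: real
  assume x: "x \<in> {t 2..t (int m + 3)}"
  let ?I = "{t 2..t (int m + 3)}"
  define Z where "Z = preimage_curve m t z x"
  define W where "W = (\<Sum>k\<le>3*m+12. \<sigma> k * bspline (nu_knots m t) 4 k x)"
  have Z0: "Z \<noteq> 0" using assms(10)[OF x] by (simp add: Z_def)
  have "t 0 \<le> t 2" "t (int m + 3) \<le> t (int m + 5)" by (rule knot_mono; simp)+
  then have x': "x \<in> {t 0..t (int m + 5)}" using x by simp
  \<comment> \<open>Going up to \<open>m + 2\<close> makes room for
    \<open>x = t (int m + 3)\<close>, the left end of the last span.\<close>
  have "x \<le> t (int (m + 3))" using x by simp
  also have "\<dots> < t (int (m + 2 + 2))" by (rule knot_strict) auto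
  finally obtain k where k: "1 \<le> k" "k \<le> m + 2" "t (int (k + 1)) \<le> x" "x < t (int (k + 2))"
    using span_cover[of x "m + 2"] x by auto
  have P: "(\<Sum>i\<le>3*m+12. p i * of_real (bspline (nu_knots m t) 4 i x)) = Z\<^sup>2"
    using assms(6)[OF x'] by (simp add: Z_def)
  have deriv: "vector_derivative (ph_curve m t r) (at x within ?I) = Z\<^sup>2"
    unfolding P[symmetric] by (rule ph_curve_derivative[OF _ x]) (fact assms(9))
  have W: "of_real W = Z * cnj Z"
    using assms(7)[OF x'] by (simp add: Z_def W_def)
  \<comment> \<open>The Pythagorean-hodograph property: the speed is \<open>Z * cnj Z\<close>, hence
    a spline without a square root.\<close>
  have norm: "of_real (norm (Z\<^sup>2)) = complex_of_real W"
    unfolding W using complex_norm_square[of Z] by (simp add: norm_power)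
  have "offset_curve ?I (ph_curve m t r) h x = ph_curve m t r x - \<i> * h * (Z\<^sup>2 / W)"
    unfolding offset_curve_def deriv norm ..
  \<comment> \<open>The common denominator \<open>W\<close> is nonzero because it equals
    \<open>Z * cnj Z\<close>.\<close>
  also have "\<dots> = (ph_curve m t r x * W - \<i> * h * Z\<^sup>2) / W"
    using Z0 W by (simp add: diff_divide_distrib)
  also have "ph_curve m t r x * W - \<i> * h * Z\<^sup>2
      = (\<Sum>k\<le>8*m+47. offset_point m t \<sigma> p r h k * bspline (tau_knots m t) 9 k x)"
    unfolding offset_point_sum[OF k] P by (simp add: ph_curve_def W_def)
  also have "W = (\<Sum>k\<le>8*m+47. offset_weight m t \<sigma> k * bspline (tau_knots m t) 9 k x)"
    unfolding offset_weight_sum[OF k] W_def ..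
  finally show "offset_curve ?I (ph_curve m t r) h x
      = (\<Sum>k\<le>8*m+47. offset_point m t \<sigma> p r h k * bspline (tau_knots m t) 9 k x)
        / (\<Sum>k\<le>8*m+47. offset_weight m t \<sigma> k * bspline (tau_knots m t) 9 k x)" .
qed

end
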